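(* Let $n$ be a positive integer, let $R$ be a simply connected region, and let $\alpha$ and $\beta$ be two order-$n$ ribbon tilings of $R$. Then: (a) $\alpha$ and $\beta$ contain the same number of tiles of each level; thus $t_{c,i}(\alpha)$ is defined if and only if $t_{c,i}(\beta)$ is defined. (b) If $c\equiv d\pmod n$ (and $t_{c,i}$, $t_{d,j}$ are defined), then $t_{c,i}(\alpha)\prec t_{d,j}(\alpha)$ if and only if $t_{c,i}(\beta)\prec t_{d,j}(\beta)$. (c) If $b\in B_R$ (and $t_{c,i}$ is defined), then $t_{c,i}(\alpha)\prec b$ if and only if $t_{c,i}(\beta)\prec b$, and $b\prec t_{c,i}(\alpha)$ if and only if $b\prec t_{c,i}(\beta)$.
   Context: Squares of the grid $\mathbb Z^2$ are indexed by integer pairs; $s_{x,y}$ is the unit square at position $(x,y)$. Two squares are adjacent if they share an edge. The square $s_{x,y}$ has level $x+y$ and color $x+y \bmod n$. A ribbon tile of order $n$ is a connected (via adjacency) set of squares containing exactly one square of each of the $n$ colors (equivalently, a sequence of $n$ squares each directly above or directly to the right of its predecessor). A tile has level $c$ if $c$ is the level of its lowest-level square. A region $R$ is a finite set of squares connected via adjacency; it is simply connected if for every square $s\notin R$ there is no connected cycle of squares in $R$ that encircles $s$ with non-zero winding number. An order-$n$ ribbon tiling of $R$ is a partition of $R$ into ribbon tiles of order $n$. $B_R$ is the set of squares not in $R$ that are adjacent to at least one square of $R$. The relation $\prec$: $s_{x,y}$ is directly left of $s_{x',y'}$ if $x+y=x'+y'$ and $x<x'$; it is indirectly left of $s_{x',y'}$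 if $|(x+y)-(x'+y')|=1$, $x\le x'$ and $y\ge y'$. Write $s\prec s'$ for squares if $s$ is directly or indirectly left of $s'$. For a tile $t$ and a square $s$: $s\prec t$ if $s\prec s'$ for some $s'\in t$, and $t\prec s$ if $s'\prec s$ for some $s'\in t$. For distinct tiles $t_1,t_2$ of a tiling: $t_1\prec t_2$ if $s_1\prec s_2$ for some $s_1\in t_1$, $s_2\in t_2$. For a tiling $\alpha$, $t_{c,i}(\alpha)$ ($i\ge1$) denotes the $i$-th tile of $\alpha$ of level $c$, counted from left to right (so $t_{c,i}(\alpha)\prec t_{c,i+1}(\alpha)$), when such a tile exists. *)

theory Defs
  imports "HOL-Complex_Analysis.Winding_Numbers" "HOL-Library.Disjoint_Sets"
begin

section \<open>Squares\<close>

type_synonym square = "int \<times> int"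

definition level :: "square \<Rightarrow> int" where
  "level s = fst s + snd s"

definition color :: "nat \<Rightarrow> square \<Rightarrow> int" where
  "color n s = level s mod int n"

definition adjacent :: "square \<Rightarrow> square \<Rightarrow> bool" where
  "adjacent s t \<longleftrightarrow> \<bar>fst s - fst t\<bar> + \<bar>snd s - snd t\<bar> = 1"

definition connected_squares :: "square set \<Rightarrow> bool" where
  "connected_squares S \<longleftrightarrow>
     (\<forall>s\<in>S. \<forall>t\<in>S. (s, t) \<in> {(u, v). u \<in> S \<and> v \<in> S \<and> adjacent u v}\<^sup>*)"

section \<open>Regions\<close>

definition region :: "square set \<Rightarrow> bool" where
  "region R \<longleftrightarrow> finite R \<and> connected_squares R"

text \<open>A cycle is a closed walk, given as a list whose last entry repeats the first.
  Squares may be revisited; since every closed walk decomposes into simple cycles and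
  back-and-forth steps, this does not affect the notion of simple connectivity.\<close>

definition square_cycle :: "square list \<Rightarrow> bool" where
  "square_cycle ss \<longleftrightarrow> ss \<noteq> [] \<and> hd ss = last ss \<and> successively adjacent ss"

text \<open>Squares are placed in the complex plane so that the square at position \<open>(x, y)\<close> has
  centre \<open>x + y\<i>\<close>; a walk is traced along the segments joining consecutive centres.\<close>

definition center :: "square \<Rightarrow> complex" where
  "center s = Complex (of_int (fst s)) (of_int (snd s))"

fun walk_path :: "square list \<Rightarrow> real \<Rightarrow> complex" where
  "walk_path [] = linepath 0 0"
| "walk_path [s] = linepath (center s) (center s)"
| "walk_path (s # t # ss) = linepath (center s) (center t) +++ walk_path (t # ss)"

definition simply_connected_region :: "square set \<Rightarrow> bool" where
  "simply_connected_region R \<longleftrightarrow> region R \<and>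
     (\<forall>s. s \<notin> R \<longrightarrow>
        \<not> (\<exists>ss. square_cycle ss \<and> set ss \<subseteq> R \<and> winding_number (walk_path ss) (center s) \<noteq> 0))"

definition outer_boundary :: "square set \<Rightarrow> square set" where
  "outer_boundary R = {s. s \<notin> R \<and> (\<exists>r\<in>R. adjacent s r)}"

section \<open>Ribbon tiles and tilings\<close>

definition ribbon_tile :: "nat \<Rightarrow> square set \<Rightarrow> bool" where
  "ribbon_tile n t \<longleftrightarrow> connected_squares t \<and> (\<forall>k\<in>{0..<int n}. \<exists>!s. s \<in> t \<and> color n s = k)"

definition tile_level :: "square set \<Rightarrow> int" where
  "tile_level t = Min (level ` t)"

definition ribbon_tiling :: "nat \<Rightarrow> square set \<Rightarrow> square set set \<Rightarrow> bool" where
  "ribbon_tiling n R \<alpha> \<longleftrightarrow> partition_on R \<alpha> \<and> (\<forall>t\<in>\<alpha>. ribbon_tile n t)"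

section \<open>The left-of relation\<close>

definition directly_left :: "square \<Rightarrow> square \<Rightarrow> bool" where
  "directly_left s s' \<longleftrightarrow> level s = level s' \<and> fst s < fst s'"

definition indirectly_left :: "square \<Rightarrow> square \<Rightarrow> bool" where
  "indirectly_left s s' \<longleftrightarrow> \<bar>level s - level s'\<bar> = 1 \<and> fst s \<le> fst s' \<and> snd s \<ge> snd s'"

definition square_left :: "square \<Rightarrow> square \<Rightarrow> bool" where
  "square_left s s' \<longleftrightarrow> directly_left s s' \<or> indirectly_left s s'"

definition square_left_tile :: "square \<Rightarrow> square set \<Rightarrow> bool" where
  "square_left_tile s t \<longleftrightarrow> (\<exists>s'\<in>t. square_left s s')"

definition tile_left_square :: "square set \<Rightarrow> square \<Rightarrow> bool" where
  "tile_left_square t s \<longleftrightarrow> (\<exists>s'\<in>t. square_left s' s)"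

text \<open>Distinctness matters: adjacent squares are always comparable, so without it every tile
  with at least two squares would be left of itself.\<close>

definition tile_left :: "square set \<Rightarrow> square set \<Rightarrow> bool" where
  "tile_left t\<^sub>1 t\<^sub>2 \<longleftrightarrow> t\<^sub>1 \<noteq> t\<^sub>2 \<and> (\<exists>s\<^sub>1\<in>t\<^sub>1. \<exists>s\<^sub>2\<in>t\<^sub>2. square_left s\<^sub>1 s\<^sub>2)"

section \<open>Enumerating the tiles of a given level\<close>

definition tiles_of_level :: "square set set \<Rightarrow> int \<Rightarrow> square set set" where
  "tiles_of_level \<alpha> c = {t \<in> \<alpha>. tile_level t = c}"

text \<open>The tiles of one level in a tiling are linearly ordered by \<^const>\<open>tile_left\<close>, so the
  \<open>i\<close>-th one, counting from \<open>1\<close>, is the one with exactly \<open>i - 1\<close> tiles of its level to its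
  left.\<close>

definition is_nth_tile :: "square set set \<Rightarrow> int \<Rightarrow> nat \<Rightarrow> square set \<Rightarrow> bool" where
  "is_nth_tile \<alpha> c i t \<longleftrightarrow>
     t \<in> tiles_of_level \<alpha> c \<and> card {u \<in> tiles_of_level \<alpha> c. tile_left u t} + 1 = i"

definition nth_tile_defined :: "square set set \<Rightarrow> int \<Rightarrow> nat \<Rightarrow> bool" where
  "nth_tile_defined \<alpha> c i \<longleftrightarrow> (\<exists>t. is_nth_tile \<alpha> c i t)"

definition nth_tile :: "square set set \<Rightarrow> int \<Rightarrow> nat \<Rightarrow> square set" where
  "nth_tile \<alpha> c i = (THE t. is_nth_tile \<alpha> c i t)"

end

theory Submission
  imports Defs
begin

text \<open>
  In the strip formed by two consecutive levels, the squares of \<open>R\<close> sit on a line, tiles crossing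
  the strip are dominoes, and the other squares are tops of tiles ending below the strip's middle or
  bottoms of tiles starting above it. At any position not interrupted by a domino, counting squares to
  the left relates the number of tiles of level \<open>c\<close> to the left to the number of tiles of level
  \<open>c + n\<close> to the left by a quantity that depends on \<open>R\<close> only. Far to the right this gives (a).

  For a square \<open>b\<close> outside \<open>R\<close>, consider the numbers of tiles of each level to the left of \<open>b\<close>.
  By the balance above, their differences between two tilings depend only on the level modulo \<open>n\<close>;
  they do not change when \<open>b\<close> makes a king move outside \<open>R\<close>, and they vanish far away. Simple
  connectivity lets \<open>b\<close> escape to infinity by king moves, which gives (c). Otherwise the component
  \<open>C\<close> of \<open>b\<close> would be finite, and the sum of the boundaries of all plaquettes meeting \<open>C\<close> would be
  a cycle in \<open>R\<close> winding once around \<open>b\<close>.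

  For (b), the number of tiles of level \<open>c + n\<close> to the left of the \<open>i\<close>-th tile of level \<open>c\<close> is
  determined by the balance at its top square: if the tops in the two tilings differ, all squares of
  the strip between them lie in \<open>R\<close> by (c), and they alternate between the two levels.
\<close>

section \<open>The complement of a simply connected region\<close>

text \<open>Holes of \<open>R\<close> must be allowed to escape diagonally, since walks in \<open>R\<close> only use edges.\<close>

definition king_adjacent :: "square \<Rightarrow> square \<Rightarrow> bool" where
  "king_adjacent u v \<longleftrightarrow> \<bar>fst u - fst v\<bar> \<le> 1 \<and> \<bar>snd u - snd v\<bar> \<le> 1"

definition complement_component :: "square set \<Rightarrow> square \<Rightarrow> square set" where
  "complement_component R s = {(u, v). u \<notin> R \<and> v \<notin> R \<and> king_adjacent u v}\<^sup>* `` {s}"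

section \<open>Discrete line integrals and potentials\<close>

fun walk_sum :: "(square \<Rightarrow> square \<Rightarrow> 'a::ab_group_add) \<Rightarrow> square list \<Rightarrow> 'a" where
  "walk_sum w [] = 0"
| "walk_sum w [u] = 0"
| "walk_sum w (u # v # us) = w u v + walk_sum w (v # us)"

lemma walk_sum_append:
  assumes "us \<noteq> []" "vs \<noteq> []"
  shows "walk_sum w (us @ vs) = walk_sum w us + w (last us) (hd vs) + walk_sum w vs"
  using assms
proof (induction w us rule: walk_sum.induct)
  case (2 w u)
  then show ?case by (cases vs) auto
qed (auto simp: algebra_simps)

lemma adjacent_sym: "adjacent u v \<longleftrightarrow> adjacent v u"
  by (auto simp: adjacent_def abs_minus_commute)

lemma walk_sum_rev:
  assumes "\<And>u v. adjacent u v \<Longrightarrow> w v u = - w u v" "successively adjacent us"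
  shows "walk_sum w (rev us) = - walk_sum w us"
  using assms(2)
proof (induction us rule: induct_list012)
  case (3 u v us)
  have "walk_sum w (rev (u # v # us)) = walk_sum w (rev (v # us) @ [u])" by simp
  also have "\<dots> = walk_sum w (rev (v # us)) + w v u"
    by (subst walk_sum_append) (auto simp: last_rev)
  finally show ?case using 3 assms(1)[of u v] by simp
qed auto

lemma walk_exists:
  assumes "connected_squares R" "r \<in> R" "v \<in> R"
  shows "\<exists>us. us \<noteq> [] \<and> hd us = r \<and> last us = v \<and> set us \<subseteq> R \<and> successively adjacent us"
proof -
  have "(r, v) \<in> {(u, v). u \<in> R \<and> v \<in> R \<and> adjacent u v}\<^sup>*"
    using assms by (auto simp: connected_squares_def)
  then show ?thesis
  proof (induction rule: rtrancl_induct)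
    case base
    then show ?case using assms(2) by (intro exI[of _ "[r]"]) auto
  next
    case (step y z)
    then obtain us where "us \<noteq> []" "hd us = r" "last us = y" "set us \<subseteq> R" "successively adjacent us"
      by blast
    with step(2) show ?case
      by (intro exI[of _ "us @ [z]"]) (auto simp: successively_append_iff)
  qed
qed

text \<open>Line integrals from a fixed base square do not depend on the walk: out along one walk,
  over an edge and back along another is a cycle.\<close>

lemma potential_exists:
  fixes w :: "square \<Rightarrow> square \<Rightarrow> 'a::ab_group_add"
  assumes conn: "connected_squares R"
    and anti: "\<And>u v. adjacent u v \<Longrightarrow> w v u = - w u v"
    and closed: "\<And>us. square_cycle us \<Longrightarrow> set us \<subseteq> R \<Longrightarrow> walk_sum w us = 0"
  obtains f where "\<And>u v. u \<in> R \<Longrightarrow> v \<in> R \<Longrightarrow> adjacent u v \<Longrightarrow> w u v = f v - f u"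
proof (cases "R = {}")
  case True
  then show ?thesis using that by blast
next
  case False
  then obtain r where r: "r \<in> R" by blast
  define walk where "walk v us \<longleftrightarrow>
    us \<noteq> [] \<and> hd us = r \<and> last us = v \<and> set us \<subseteq> R \<and> successively adjacent us" for v us
  define f where "f v = walk_sum w (SOME us. walk v us)" for v
  show ?thesis
  proof (rule that)
    fix u v assume uv: "u \<in> R" "v \<in> R" "adjacent u v"
    define us vs where "us = (SOME us. walk u us)" and "vs = (SOME us. walk v us)"
    have "\<exists>us. walk u us" "\<exists>us. walk v us"
      unfolding walk_def using walk_exists[OF conn r] uv by blast+
    then have us: "walk u us" and vs: "walk v vs"
      unfolding us_def vs_def by (simp_all add: someI_ex)
    have eq: "(\<lambda>x y. adjacent y x) = adjacent" using adjacent_sym by blast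
    have flip: "successively adjacent (rev vs)"
      unfolding successively_rev by (subst eq) (use vs in \<open>simp add: walk_def\<close>)
    have "square_cycle (us @ rev vs)"
      using us vs uv flip
      by (auto simp: square_cycle_def walk_def successively_append_iff hd_rev last_rev)
    then have "walk_sum w (us @ rev vs) = 0"
      using closed us vs by (auto simp: walk_def)
    moreover have "walk_sum w (us @ rev vs) = f u + w u v - f v"
    proof -
      have "f u = walk_sum w us" "f v = walk_sum w vs" by (simp_all add: f_def us_def vs_def)
      moreover have "walk_sum w (rev vs) = - walk_sum w vs"
        by (rule walk_sum_rev) (use anti vs in \<open>auto simp: walk_def\<close>)
      ultimately show ?thesis
        using us vs walk_sum_append[of us "rev vs" w]
        by (simp add: walk_def hd_rev)
    qed
    ultimately show "w u v = f v - f u" by (simp add: algebra_simps)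
  qed
qed

text \<open>The plaquettes are the faces of the grid of centres, named by their lower left corner;
  the boundary is traversed counterclockwise.\<close>

definition circulation :: "(square \<Rightarrow> square \<Rightarrow> 'a::ab_group_add) \<Rightarrow> square \<Rightarrow> 'a" where
  "circulation w = (\<lambda>(x, y). w (x, y) (x + 1, y) + w (x + 1, y) (x + 1, y + 1)
     + w (x + 1, y + 1) (x, y + 1) + w (x, y + 1) (x, y))"

definition corners :: "square \<Rightarrow> square set" where
  "corners = (\<lambda>(x, y). {(x, y), (x + 1, y), (x, y + 1), (x + 1, y + 1)})"

lemma finite_plaquettes:
  assumes "finite C"
  shows "finite {p. corners p \<inter> C \<noteq> {}}"
proof (rule finite_subset)
  show "{p. corners p \<inter> C \<noteq> {}} \<subseteq> (\<Union>c\<in>C. {fst c - 1..fst c} \<times> {snd c - 1..snd c})"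
    by (auto simp: corners_def)
qed (use assms in auto)

text \<open>Both \<open>K\<close> and its shift by \<open>d\<close> contain \<open>E\<close>, and
  \<open>h\<close> vanishes on the rest of either, so both sums reduce to the sum over
  \<open>E\<close>.\<close>

lemma sum_shift_edges:
  fixes h :: "square \<Rightarrow> 'a::ab_group_add"
  assumes fin: "finite K" and sub: "E \<subseteq> K" "\<And>e. e \<in> E \<Longrightarrow> e - d \<in> K"
    and zero: "\<And>e. e \<in> K \<Longrightarrow> e \<notin> E \<Longrightarrow> h e = 0" "\<And>e. e \<in> K \<Longrightarrow> e + d \<notin> E \<Longrightarrow> h (e + d) = 0"
  shows "(\<Sum>e\<in>K. h (e + d)) = (\<Sum>e\<in>K. h e)"
proof -
  have "(\<Sum>e\<in>K. h (e + d)) = (\<Sum>e\<in>(\<lambda>e. e + d) ` K. h e)"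
    by (subst sum.reindex) (auto simp: inj_on_def)
  also have "\<dots> = (\<Sum>e\<in>E. h e)"
  proof (rule sum.mono_neutral_right)
    show "E \<subseteq> (\<lambda>e. e + d) ` K"
    proof
      fix e assume "e \<in> E"
      then show "e \<in> (\<lambda>e. e + d) ` K" using sub(2) by (intro image_eqI[of _ _ "e - d"]) auto
    qed
  qed (use fin zero in auto)
  also have "\<dots> = (\<Sum>e\<in>K. h e)"
    using fin sub zero by (intro sum.mono_neutral_left) auto
  finally show ?thesis .
qed

text \<open>Once a potential is subtracted, \<open>w\<close> vanishes on edges inside \<open>R\<close>; every other edge of a
  plaquette meeting \<open>C\<close> has an endpoint in \<open>C\<close>, so both plaquettes containing it are summed and
  its two contributions cancel.\<close>

lemma sum_circulation_zero:
  fixes w :: "square \<Rightarrow> square \<Rightarrow> 'a::ab_group_add"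
  assumes fin: "finite C"
    and nbr: "\<And>u v. u \<in> C \<Longrightarrow> king_adjacent u v \<Longrightarrow> v \<in> C \<union> R"
    and anti: "\<And>u v. adjacent u v \<Longrightarrow> w v u = - w u v"
    and pot: "\<And>u v. u \<in> R \<Longrightarrow> v \<in> R \<Longrightarrow> adjacent u v \<Longrightarrow> w u v = f v - f u"
  shows "(\<Sum>p | corners p \<inter> C \<noteq> {}. circulation w p) = 0"
proof -
  define K where "K = {p. corners p \<inter> C \<noteq> {}}"
  have finK: "finite K" unfolding K_def by (rule finite_plaquettes[OF fin])
  \<comment> \<open>Removing the gradient of \<open>f\<close> changes no circulation, since a
    gradient telescopes around a plaquette.\<close>
  define g where "g u v = w u v - (f v - f u)" for u v
  define h where "h = (\<lambda>u::square. g u (u + (1, 0)))"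
  define v where "v = (\<lambda>u::square. g u (u + (0, 1)))"
  have inR: "u \<in> R" if "p \<in> K" "u \<in> corners p" "u \<notin> C" for p u
  proof -
    obtain c where "c \<in> C" "c \<in> corners p" using \<open>p \<in> K\<close> by (auto simp: K_def)
    moreover from this have "king_adjacent c u"
      using that by (auto simp: corners_def king_adjacent_def split: prod.splits)
    ultimately show ?thesis using nbr that by blast
  qed
  have g0: "g u u' = 0" if "u \<in> R" "u' \<in> R" "adjacent u u'" for u u'
    using pot that by (simp add: g_def)
  have g_anti: "g u' u = - g u u'" if "adjacent u u'" for u u'
    using anti[OF that] by (simp add: g_def)
  have h: "(\<Sum>e\<in>K. h (e + (0, 1))) = (\<Sum>e\<in>K. h e)"
  \<comment> \<open>\<open>E\<close> holds the horizontal edges, named by their left end, with an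
    end in \<open>C\<close>. The plaquettes above and below such an edge both lie in
    \<open>K\<close>.\<close>
  proof (rule sum_shift_edges[OF finK, where E = "{e. e \<in> C \<or> e + (1, 0) \<in> C}"])
    fix e assume e: "e \<in> K"
    show "h e = 0" if "e \<notin> {e. e \<in> C \<or> e + (1, 0) \<in> C}"
      unfolding h_def using that
      by (intro g0 inR[OF e]) (auto simp: corners_def adjacent_def split: prod.splits)
    show "h (e + (0, 1)) = 0" if "e + (0, 1) \<notin> {e. e \<in> C \<or> e + (1, 0) \<in> C}"
      unfolding h_def using that
      by (intro g0 inR[OF e]) (auto simp: corners_def adjacent_def split: prod.splits)
  qed (auto simp: K_def corners_def split: prod.splits)
  have v: "(\<Sum>e\<in>K. v (e + (1, 0))) = (\<Sum>e\<in>K. v e)"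
  proof (rule sum_shift_edges[OF finK, where E = "{e. e \<in> C \<or> e + (0, 1) \<in> C}"])
    fix e assume e: "e \<in> K"
    show "v e = 0" if "e \<notin> {e. e \<in> C \<or> e + (0, 1) \<in> C}"
      unfolding v_def using that
      by (intro g0 inR[OF e]) (auto simp: corners_def adjacent_def split: prod.splits)
    show "v (e + (1, 0)) = 0" if "e + (1, 0) \<notin> {e. e \<in> C \<or> e + (0, 1) \<in> C}"
      unfolding v_def using that
      by (intro g0 inR[OF e]) (auto simp: corners_def adjacent_def split: prod.splits)
  qed (auto simp: K_def corners_def split: prod.splits)
  have "circulation w p = h p - h (p + (0, 1)) + (v (p + (1, 0)) - v p)" for p
  proof -
    obtain x y where p: "p = (x, y)" by force
    have "circulation w p = circulation g p"
      by (simp add: circulation_def g_def p algebra_simps)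
    also have "\<dots> = h p - h (p + (0, 1)) + (v (p + (1, 0)) - v p)"
      using g_anti[of "(x, y + 1)" "(x + 1, y + 1)"] g_anti[of "(x, y)" "(x, y + 1)"]
      by (simp add: circulation_def p h_def v_def adjacent_def algebra_simps)
    finally show ?thesis .
  qed
  then show ?thesis
    using h v by (simp add: K_def[symmetric] sum.distrib sum_subtractf)
qed


section \<open>Walks as paths in the plane and their winding numbers\<close>

lemma pathstart_walk_path [simp]: "us \<noteq> [] \<Longrightarrow> pathstart (walk_path us) = center (hd us)"
  by (induction us rule: walk_path.induct) auto

lemma pathfinish_walk_path [simp]: "us \<noteq> [] \<Longrightarrow> pathfinish (walk_path us) = center (last us)"
  by (induction us rule: walk_path.induct) auto

lemma path_walk_path [simp]: "us \<noteq> [] \<Longrightarrow> path (walk_path us)"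
  by (induction us rule: walk_path.induct) auto

lemma path_image_walk_path:
  assumes "us \<noteq> []" "successively adjacent us" "z \<in> path_image (walk_path us)"
  shows "\<exists>u\<in>set us. \<exists>v\<in>set us. (u = v \<or> adjacent u v) \<and> z \<in> closed_segment (center u) (center v)"
  using assms
proof (induction us rule: walk_path.induct)
  case (3 u v us)
  then show ?case
    by (auto simp: path_image_join)
qed auto

lemma closed_segment_centers:
  assumes "u = v \<or> adjacent u v" "z \<in> closed_segment (center u) (center v)"
  shows "\<exists>m. (Re z = of_int m \<and> fst u = m \<and> fst v = m) \<or> (Im z = of_int m \<and> snd u = m \<and> snd v = m)"
proof -
  obtain t where "z = (1 - t) *\<^sub>R center u + t *\<^sub>R center v"
    using assms(2) by (auto simp: closed_segment_def)
  then have "Re z = (1 - t) * of_int (fst u) + t * of_int (fst v)"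
    "Im z = (1 - t) * of_int (snd u) + t * of_int (snd v)"
    by (simp_all add: center_def)
  moreover have "fst u = fst v \<or> snd u = snd v"
    using assms(1) by (auto simp: adjacent_def)
  ultimately show ?thesis by (auto simp: algebra_simps)
qed

text \<open>The midpoint of the plaquette named \<open>s\<close>. Both coordinates are
  half-integers, so no grid edge contains it.\<close>

definition diagonal_point :: "square \<Rightarrow> complex" where
  "diagonal_point s = center s + Complex (1/2) (1/2)"

text \<open>Past its start the half-diagonal has no integral coordinate, while a grid edge has one
  throughout. So they can only meet in the centre of \<open>s\<close>, and a grid edge through a
  centre ends there.\<close>

lemma closed_segment_diagonal:
  assumes "u = v \<or> adjacent u v"
    and "z \<in> closed_segment (center u) (center v)"
    and "z \<in> closed_segment (center s) (diagonal_point s)"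
  shows "u = s \<or> v = s" "z = center s"
proof -
  obtain t where t: "0 \<le> t" "t \<le> 1" "z = (1 - t) *\<^sub>R center s + t *\<^sub>R diagonal_point s"
    using assms(3) by (auto simp: closed_segment_def)
  then have z: "Re z = of_int (fst s) + t / 2" "Im z = of_int (snd s) + t / 2"
    by (simp_all add: center_def diagonal_point_def algebra_simps)
  obtain m where "Re z = of_int m \<or> Im z = of_int m"
    using closed_segment_centers[OF assms(1,2)] by blast
  then obtain k :: int where "t / 2 = of_int k"
    using z by (metis add_diff_cancel_left' of_int_diff)
  moreover from this have "k = 0" using t(1,2) by linarith
  ultimately have "t = 0" by simp
  then show zs: "z = center s" using t(3) by simp
  obtain r where r: "0 \<le> r" "r \<le> 1" "z = (1 - r) *\<^sub>R center u + r *\<^sub>R center v"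
    using assms(2) by (auto simp: closed_segment_def)
  then have "of_int (fst s) = (1 - r) * of_int (fst u) + r * of_int (fst v)"
    "of_int (snd s) = (1 - r) * of_int (snd u) + r * of_int (snd v)"
    using zs by (auto simp: center_def complex_eq_iff)
  then have e: "of_int (fst s - fst u) = r * of_int (fst v - fst u)"
    "of_int (snd s - snd u) = r * of_int (snd v - snd u)"
    by (simp_all add: algebra_simps)
  \<comment> \<open>Along a proper edge one coordinate changes by exactly 1, so at the integral
    point \<open>z\<close> the parameter \<open>r\<close> is an integer.\<close>
  have "\<exists>k::int. r = of_int k \<or> u = v"
  proof (cases "u = v")
    case False
    then have "fst v - fst u = 1 \<or> fst v - fst u = -1 \<or> snd v - snd u = 1 \<or> snd v - snd u = -1"
      using assms(1) unfolding adjacent_def by presburger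
    then have "r = of_int (fst s - fst u) \<or> r = of_int (fst u - fst s) \<or>
        r = of_int (snd s - snd u) \<or> r = of_int (snd u - snd s)"
      using e by fastforce
    then show ?thesis by blast
  qed auto
  then consider "u = v" | "r = 0" | "r = 1"
    using r(1,2) by force
  then show "u = s \<or> v = s"
    using e by cases (auto simp: prod_eq_iff)
qed

lemma diagonal_point_notin_segment:
  assumes "u = v \<or> adjacent u v"
  shows "diagonal_point s \<notin> closed_segment (center u) (center v)"
  using closed_segment_diagonal(2)[OF assms, of "diagonal_point s" s]
  by (auto simp: diagonal_point_def complex_eq_iff)

text \<open>The share of one edge in a winding number. A single edge is not a closed path, so the
  value need not be an integer.\<close>

definition step_winding :: "square \<Rightarrow> square \<Rightarrow> square \<Rightarrow> complex" where
  "step_winding s u v = winding_number (linepath (center u) (center v)) (diagonal_point s)"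

lemma step_winding_anti:
  assumes "adjacent u v"
  shows "step_winding s v u = - step_winding s u v"
  using winding_number_reversepath[of "linepath (center u) (center v)" "diagonal_point s"]
    diagonal_point_notin_segment[of u v s] assms
  by (simp add: step_winding_def)

lemma winding_number_walk_path:
  assumes "us \<noteq> []" "successively adjacent us"
  shows "winding_number (walk_path us) (diagonal_point s) = walk_sum (step_winding s) us"
  using assms
proof (induction us rule: walk_path.induct)
  case (2 u)
  then show ?case
    using diagonal_point_notin_segment[of u u s] by (auto simp: winding_number_zero_const)
next
  case (3 u v us)
  have "diagonal_point s \<notin> path_image (walk_path (v # us))"
    using path_image_walk_path[of "v # us" "diagonal_point s"] 3(3) diagonal_point_notin_segment
    by (metis list.distinct(1) successively.simps(3))
  then show ?case
    using 3 diagonal_point_notin_segment[of u v s]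
    by (simp add: winding_number_join step_winding_def)
qed auto

text \<open>The centre of \<open>s\<close> lies on grid edges; it is traded for a point off the grid that no walk
  avoiding \<open>s\<close> separates from it.\<close>

lemma winding_number_center:
  assumes "square_cycle us" "s \<notin> set us"
  shows "winding_number (walk_path us) (center s) = winding_number (walk_path us) (diagonal_point s)"
proof (rule winding_number_eq)
  show "closed_segment (center s) (diagonal_point s) \<inter> path_image (walk_path us) = {}"
    using assms path_image_walk_path[of us] closed_segment_diagonal(1)
    unfolding square_cycle_def by blast
qed (use assms in \<open>auto simp: square_cycle_def\<close>)

text \<open>The boundary of a plaquette is a rectangle that winds once around its interior, and
  \<open>diagonal_point s\<close> is interior to the plaquette \<open>s\<close> alone.\<close>

lemma circulation_step_winding:
  "circulation (step_winding s) p = (if p = s then 1 else 0)"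
proof -
  obtain x y where p: "p = (x, y)" by force
  let ?c = "\<lambda>i j. center (x + i, y + j)" and ?z = "diagonal_point s"
  have z: "?z \<notin> closed_segment (?c 0 0) (?c 1 0)" "?z \<notin> closed_segment (?c 1 0) (?c 1 1)"
    "?z \<notin> closed_segment (?c 1 1) (?c 0 1)" "?z \<notin> closed_segment (?c 0 1) (?c 0 0)"
    by (rule diagonal_point_notin_segment; simp add: adjacent_def)+
  have r: "rectpath (?c 0 0) (?c 1 1) = linepath (?c 0 0) (?c 1 0) +++ linepath (?c 1 0) (?c 1 1) +++
      linepath (?c 1 1) (?c 0 1) +++ linepath (?c 0 1) (?c 0 0)"
    by (simp add: rectpath_def center_def Let_def)
  have "circulation (step_winding s) p = winding_number (rectpath (?c 0 0) (?c 1 1)) ?z"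
    unfolding r using z
    by (simp add: winding_number_join path_image_join step_winding_def circulation_def p add.assoc)
  also have "\<dots> = (if p = s then 1 else 0)"
  proof (cases "p = s")
    case True
    then show ?thesis
      by (auto intro!: winding_number_rectpath
          simp: p in_box_complex_iff diagonal_point_def center_def)
  next
    case False
    have "?z \<notin> cbox (?c 0 0) (?c 1 1)"
    proof
      assume "?z \<in> cbox (?c 0 0) (?c 1 1)"
      then have "real_of_int x \<le> of_int (fst s) + 1/2" "of_int (fst s) + 1/2 \<le> real_of_int x + 1"
        "real_of_int y \<le> of_int (snd s) + 1/2" "of_int (snd s) + 1/2 \<le> real_of_int y + 1"
        by (auto simp: in_cbox_complex_iff diagonal_point_def center_def)
      then have "x = fst s" "y = snd s" by linarith+
      then show False using False p by simp
    qed
    then show ?thesis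
      using False by (auto intro!: winding_number_rectpath_outside simp: center_def)
  qed
  finally show ?thesis .
qed

text \<open>No cycle in \<open>R\<close> winds around \<open>s\<close>, so
  \<open>step_winding s\<close> has a potential on \<open>R\<close>. For a finite component its
  total circulation over the plaquettes meeting the component would be 0, but plaquette
  \<open>s\<close> is among them and makes it 1.\<close>

proposition infinite_complement_component:
  assumes R: "simply_connected_region R" and s: "s \<notin> R"
  shows "infinite (complement_component R s)"
proof
  define C where "C = complement_component R s"
  assume "finite (complement_component R s)"
  then have fin: "finite C" by (simp add: C_def)
  have CR: "u \<notin> R" if "u \<in> C" for u
    using that s unfolding C_def complement_component_def by (auto elim: rtranclE)
  have nbr: "v \<in> C \<union> R" if "u \<in> C" "king_adjacent u v" for u v
    using that CR[OF that(1)] unfolding C_def complement_component_def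
    by (auto intro: rtrancl_into_rtrancl)
  have "s \<in> C" by (simp add: C_def complement_component_def)
  have "walk_sum (step_winding s) us = 0" if us: "square_cycle us" "set us \<subseteq> R" for us
  proof -
    have "winding_number (walk_path us) (center s) = 0"
      using R s us unfolding simply_connected_region_def by blast
    moreover have "s \<notin> set us" using us s by blast
    ultimately show ?thesis
      using winding_number_center[OF us(1)] winding_number_walk_path[of us s] us(1)
      by (auto simp: square_cycle_def)
  qed
  moreover have "connected_squares R"
    using R by (simp add: simply_connected_region_def region_def)
  ultimately obtain f where f: "\<And>u v. u \<in> R \<Longrightarrow> v \<in> R \<Longrightarrow> adjacent u v \<Longrightarrow> step_winding s u v = f v - f u"
    using potential_exists[of R "step_winding s"] step_winding_anti by metis
  have "(\<Sum>p | corners p \<inter> C \<noteq> {}. circulation (step_winding s) p) = 0"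
    by (rule sum_circulation_zero[OF fin nbr step_winding_anti f])
  moreover have "(\<Sum>p | corners p \<inter> C \<noteq> {}. circulation (step_winding s) p) = 1"
  proof -
    have "s \<in> {p. corners p \<inter> C \<noteq> {}}"
      using \<open>s \<in> C\<close> by (cases s) (auto simp: corners_def)
    then show ?thesis
      using finite_plaquettes[OF fin] by (simp add: circulation_step_winding)
  qed
  ultimately show False by simp
qed

section \<open>Tiles and their order\<close>

text \<open>Within two consecutive levels, \<open>horiz\<close> lines up the squares along a zigzag strip indexed by the
  integers, with parity telling the two levels apart.\<close>

definition horiz :: "square \<Rightarrow> int" where
  "horiz s = fst s - snd s"

text \<open>\<open>level\<close> and \<open>horiz\<close> have equal parity, so squares on
  neighbouring levels differ in \<open>horiz\<close>; the weak inequalities of the indirect case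
  thus become one strict comparison.\<close>

lemma square_left_iff: "square_left s t \<longleftrightarrow> \<bar>level s - level t\<bar> \<le> 1 \<and> horiz s < horiz t"
  unfolding square_left_def directly_left_def indirectly_left_def level_def horiz_def by presburger

lemma adjacent_iff: "adjacent s t \<longleftrightarrow> \<bar>level s - level t\<bar> = 1 \<and> \<bar>horiz s - horiz t\<bar> = 1"
  unfolding adjacent_def level_def horiz_def by presburger

lemma square_eqI: "level s = level t \<Longrightarrow> horiz s = horiz t \<Longrightarrow> s = t"
  by (auto simp: level_def horiz_def prod_eq_iff)

lemma even_horiz_iff: "even (horiz s) \<longleftrightarrow> even (level s)"
  by (simp add: horiz_def level_def)

text \<open>A discrete intermediate value argument: each step changes the level by exactly
  one.\<close>

lemma crossing_edge:
  assumes "(s, s') \<in> {(u, v). u \<in> t \<and> v \<in> t \<and> adjacent u v}\<^sup>*" "level s \<le> l" "l < level s'"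
  shows "\<exists>u\<in>t. \<exists>v\<in>t. adjacent u v \<and> level u = l \<and> level v = l + 1"
  using assms
proof (induction rule: rtrancl_induct)
  case (step u v)
  show ?case
  proof (cases "l < level u")
    case False
    then have "level u = l" "level v = l + 1"
      using step by (auto simp: adjacent_iff)
    then show ?thesis using step by blast
  qed (use step in auto)
qed auto

text \<open>The two sets of predecessors are nested, and \<open>t\<close> itself separates them if
  \<open>g t < p\<close>. Comparisons of positions thereby become comparisons of counts, which can
  be matched between two tilings.\<close>

lemma card_rank_less_iff:
  fixes g :: "'a \<Rightarrow> 'b::linorder"
  assumes "finite A" "t \<in> A"
  shows "g t < p \<longleftrightarrow> card {u \<in> A. g u < g t} < card {u \<in> A. g u < p}"
proof
  assume "g t < p"
  then have "t \<in> {u \<in> A. g u < p} - {u \<in> A. g u < g t}" "{u \<in> A. g u < g t} \<subseteq> {u \<in> A. g u < p}"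
    using assms(2) by auto
  then show "card {u \<in> A. g u < g t} < card {u \<in> A. g u < p}"
    using assms(1) by (intro psubset_card_mono) (simp, blast)
next
  assume *: "card {u \<in> A. g u < g t} < card {u \<in> A. g u < p}"
  show "g t < p"
  proof (rule ccontr)
    assume "\<not> g t < p"
    then have "card {u \<in> A. g u < p} \<le> card {u \<in> A. g u < g t}"
      using assms by (intro card_mono) auto
    with * show False by simp
  qed
qed

lemma card_rank_image:
  fixes g :: "'a \<Rightarrow> 'b::linorder"
  assumes "finite A" "inj_on g A"
  shows "bij_betw (\<lambda>t. card {u \<in> A. g u < g t}) A {..<card A}"
proof -
  have inj: "inj_on (\<lambda>t. card {u \<in> A. g u < g t}) A"
  proof (rule inj_onI)
    fix s t assume st: "s \<in> A" "t \<in> A" and "card {u \<in> A. g u < g s} = card {u \<in> A. g u < g t}"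
    then have "\<not> g s < g t" "\<not> g t < g s"
      using card_rank_less_iff[OF assms(1) st(1), of g "g t"]
        card_rank_less_iff[OF assms(1) st(2), of g "g s"] by simp_all
    then have "g s = g t" by order
    then show "s = t" using st assms(2) by (simp add: inj_on_eq_iff)
  qed
  moreover have "(\<lambda>t. card {u \<in> A. g u < g t}) ` A \<subseteq> {..<card A}"
    using assms(1) by (intro image_subsetI) (simp, intro psubset_card_mono, auto)
  ultimately show ?thesis
    by (simp add: bij_betw_def card_image card_subset_eq)
qed

section \<open>A single ribbon tile and its squares by level\<close>

definition tile_square :: "square set \<Rightarrow> int \<Rightarrow> square" where
  "tile_square t l = (THE s. s \<in> t \<and> level s = l)"

definition horiz_at :: "square set \<Rightarrow> int \<Rightarrow> int" where
  "horiz_at t l = horiz (tile_square t l)"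

locale ribbon =
  fixes n :: nat and t :: "square set"
  assumes n: "n > 0" and tile: "ribbon_tile n t"
begin

text \<open>Every square has a color in the range, so a tile has no squares beyond the
  \<open>n\<close> prescribed ones; its finiteness follows.\<close>

lemma color_bij: "bij_betw (color n) t {0..<int n}"
  unfolding bij_betw_def
proof
  have ex1: "\<exists>!s. s \<in> t \<and> color n s = k" if "k \<in> {0..<int n}" for k
    using tile that by (simp add: ribbon_tile_def)
  have rng: "color n s \<in> {0..<int n}" for s
    using n by (simp add: color_def)
  show "inj_on (color n) t"
    using ex1[OF rng] by (auto intro!: inj_onI)
  show "color n ` t = {0..<int n}"
  proof
    show "{0..<int n} \<subseteq> color n ` t"
      using ex1 by blast
  qed (use rng in blast)
qed

lemma finite_tile [simp]: "finite t"
  using color_bij bij_betw_finite by blast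

lemma card_tile: "card t = n"
  using bij_betw_same_card[OF color_bij] by simp

lemma level_inj: "s \<in> t \<Longrightarrow> s' \<in> t \<Longrightarrow> level s = level s' \<Longrightarrow> s = s'"
  using bij_betw_imp_inj_on[OF color_bij] by (simp add: color_def inj_on_def)

lemma crossing:
  assumes "s \<in> t" "s' \<in> t" "level s \<le> l" "l < level s'"
  shows "\<exists>u\<in>t. \<exists>v\<in>t. adjacent u v \<and> level u = l \<and> level v = l + 1"
  using tile assms by (intro crossing_edge[of s s']) (auto simp: ribbon_tile_def connected_squares_def)

lemma nonempty: "t \<noteq> {}"
  using card_tile n by auto

text \<open>Connectedness leaves no gap between the lowest and the highest level, and the
  \<open>n\<close> squares have distinct levels.\<close>

lemma levels: "level ` t = {tile_level t..<tile_level t + int n}"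
proof -
  define a b where "a = Min (level ` t)" and "b = Max (level ` t)"
  have a: "a \<in> level ` t" and b: "b \<in> level ` t"
    using nonempty unfolding a_def b_def by (auto intro: Min_in Max_in)
  have "level ` t = {a..b}"
  proof
    show "level ` t \<subseteq> {a..b}"
      unfolding a_def b_def by auto
    show "{a..b} \<subseteq> level ` t"
    proof
      fix l assume l: "l \<in> {a..b}"
      show "l \<in> level ` t"
      proof (cases "l = b")
        case False
        then have "l < b" using l by auto
        then show ?thesis
          using crossing[of _ _ l] a b l by fastforce
      qed (use b in simp)
    qed
  qed
  moreover have "card (level ` t) = n"
    using card_tile level_inj by (subst card_image) (auto intro: inj_onI)
  ultimately have "b = a + int n - 1" using n by auto
  then show ?thesis
    using \<open>level ` t = {a..b}\<close> unfolding tile_level_def a_def[symmetric] by auto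
qed

lemma level_bounds: "s \<in> t \<Longrightarrow> tile_level t \<le> level s \<and> level s < tile_level t + int n"
  using levels by fastforce

lemma tile_square_eq: "s \<in> t \<Longrightarrow> tile_square t (level s) = s"
  unfolding tile_square_def using level_inj by blast

lemma tile_square:
  assumes "tile_level t \<le> l" "l < tile_level t + int n"
  shows "tile_square t l \<in> t" "level (tile_square t l) = l"
proof -
  have "l \<in> level ` t" using assms by (simp add: levels)
  then show "tile_square t l \<in> t" "level (tile_square t l) = l"
    using tile_square_eq by auto
qed

text \<open>Connectedness forces an edge of the tile between the two levels, and each level holds
  only one square of the tile.\<close>

lemma adjacent_levels:
  assumes "s \<in> t" "s' \<in> t" "level s' = level s + 1"
  shows "\<bar>horiz s - horiz s'\<bar> = 1"
proof -
  obtain u v where "u \<in> t" "v \<in> t" "adjacent u v" "level u = level s" "level v = level s + 1"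
    using crossing[of s s' "level s"] assms by auto
  moreover from this have "u = s" "v = s'"
    using level_inj assms by metis+
  ultimately show ?thesis by (simp add: adjacent_iff)
qed

lemma parity: "tile_level t \<le> l \<Longrightarrow> l < tile_level t + int n \<Longrightarrow> even (horiz_at t l) \<longleftrightarrow> even l"
  using tile_square(2) even_horiz_iff unfolding horiz_at_def by metis

lemma horiz_at_step:
  assumes "tile_level t \<le> l" "l + 1 < tile_level t + int n"
  shows "\<bar>horiz_at t l - horiz_at t (l + 1)\<bar> = 1"
  unfolding horiz_at_def using assms by (intro adjacent_levels) (auto simp: tile_square)

text \<open>Parity keeps the squares of \<open>t\<close> near \<open>b\<close> off the position of
  \<open>b\<close>, and squares of \<open>t\<close> on consecutive levels are one position apart, so
  they cannot lie on opposite sides of \<open>b\<close>.\<close>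

lemma side:
  assumes "b \<notin> t" and s: "s \<in> t" "\<bar>level s - level b\<bar> \<le> 1" and s': "s' \<in> t" "\<bar>level s' - level b\<bar> \<le> 1"
  shows "horiz s < horiz b \<longleftrightarrow> horiz s' < horiz b" "horiz s \<noteq> horiz b"
proof -
  have ne: "horiz u \<noteq> horiz b" if "u \<in> t" "\<bar>level u - level b\<bar> \<le> 1" for u
  proof
    assume *: "horiz u = horiz b"
    then have "even (level u) \<longleftrightarrow> even (level b)" by (metis even_horiz_iff)
    then have "level u = level b" using that(2) by presburger
    then show False using * square_eqI \<open>b \<notin> t\<close> that(1) by metis
  qed
  then show "horiz s \<noteq> horiz b" using s by blast
  have mid: "horiz m < horiz b \<longleftrightarrow> horiz u < horiz b"
    if "m \<in> t" "level m = level b" "u \<in> t" "\<bar>level u - level b\<bar> \<le> 1" for m u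
  proof (cases "level u = level m")
    case False
    then have "level u = level m + 1 \<or> level m = level u + 1" using that by linarith
    then have "\<bar>horiz m - horiz u\<bar> = 1"
      using adjacent_levels[of m u] adjacent_levels[of u m] that by auto
    then show ?thesis using ne[OF that(1)] ne[OF that(3,4)] that(2) by linarith
  qed (use level_inj that in blast)
  show "horiz s < horiz b \<longleftrightarrow> horiz s' < horiz b"
  proof (cases "level s = level s'")
    case True
    then show ?thesis using level_inj s s' by blast
  next
    case False
    \<comment> \<open>Two distinct levels within 1 of \<open>level b\<close> either include it or
      enclose it, and the levels of \<open>t\<close> form an interval.\<close>
    have "level b \<in> level ` t"
      using level_bounds[OF s(1)] level_bounds[OF s'(1)] False s(2) s'(2) unfolding levels by auto
    then obtain m where "m \<in> t" "level m = level b" by auto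
    then show ?thesis using mid s s' by blast
  qed
qed

end

section \<open>Left counts and the order of tiles of one level\<close>

definition left_count :: "square set set \<Rightarrow> int \<Rightarrow> int \<Rightarrow> int \<Rightarrow> nat" where
  "left_count \<alpha> c l p = card {t \<in> tiles_of_level \<alpha> c. horiz_at t l < p}"

definition left_tiles :: "square set set \<Rightarrow> int \<Rightarrow> square \<Rightarrow> nat" where
  "left_tiles \<alpha> c b = card {t \<in> tiles_of_level \<alpha> c. tile_left_square t b}"

definition left_squares :: "square set \<Rightarrow> int \<Rightarrow> int \<Rightarrow> nat" where
  "left_squares R l p = card {s \<in> R. level s = l \<and> horiz s < p}"

locale ribbon_tiled =
  fixes n :: nat and R :: "square set" and \<alpha> :: "square set set"
  assumes n: "n > 0" and fin: "finite R" and tiling: "ribbon_tiling n R \<alpha>"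
begin

lemma ribbon: "t \<in> \<alpha> \<Longrightarrow> ribbon n t"
  using n tiling by (simp add: ribbon_def ribbon_tiling_def)

lemma partition: "partition_on R \<alpha>"
  using tiling by (simp add: ribbon_tiling_def)

lemma finite_tiling [simp]: "finite \<alpha>"
  using finite_elements[OF fin partition] .

lemma finite_tiles_of_level [simp]: "finite (tiles_of_level \<alpha> c)"
  by (simp add: tiles_of_level_def)

lemma tile_subset: "t \<in> \<alpha> \<Longrightarrow> t \<subseteq> R"
  using partition by (auto simp: partition_on_def)

lemma tile_unique: "t \<in> \<alpha> \<Longrightarrow> u \<in> \<alpha> \<Longrightarrow> s \<in> t \<Longrightarrow> s \<in> u \<Longrightarrow> t = u"
  using partition by (auto simp: partition_on_def disjoint_def)

lemma tile_exists: "s \<in> R \<Longrightarrow> \<exists>t\<in>\<alpha>. s \<in> t"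
  using partition by (auto simp: partition_on_def)

lemma tiles_of_levelD:
  assumes "t \<in> tiles_of_level \<alpha> c"
  shows "t \<in> \<alpha>" "tile_level t = c" "ribbon n t"
  using assms ribbon by (auto simp: tiles_of_level_def)

lemma horiz_at_neq:
  assumes "t \<in> tiles_of_level \<alpha> c" "u \<in> tiles_of_level \<alpha> c" "t \<noteq> u" "c \<le> l" "l < c + int n"
  shows "horiz_at t l \<noteq> horiz_at u l"
proof
  assume "horiz_at t l = horiz_at u l"
  moreover note t = tiles_of_levelD[OF assms(1)] and u = tiles_of_levelD[OF assms(2)]
  note sq = ribbon.tile_square[OF t(3), of l] ribbon.tile_square[OF u(3), of l]
  ultimately have "tile_square t l = tile_square u l"
    using sq assms t(2) u(2) by (intro square_eqI) (auto simp: horiz_at_def)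
  then show False
    using sq assms t(2) u(2) tile_unique[OF t(1) u(1)] by auto
qed

text \<open>Equal parity makes the gap at least 2, and it shrinks by at most 2; equality is excluded
  because the tiles are disjoint.\<close>

lemma horiz_at_less_step:
  assumes "t \<in> tiles_of_level \<alpha> c" "u \<in> tiles_of_level \<alpha> c" "c \<le> l" "l + 1 < c + int n"
    and "horiz_at t l < horiz_at u l"
  shows "horiz_at t (l + 1) < horiz_at u (l + 1)"
proof -
  note t = tiles_of_levelD[OF assms(1)] and u = tiles_of_levelD[OF assms(2)]
  have "horiz_at t (l + 1) \<noteq> horiz_at u (l + 1)"
    using assms by (intro horiz_at_neq[of _ c]) auto
  moreover have "\<bar>horiz_at t l - horiz_at t (l + 1)\<bar> = 1" "\<bar>horiz_at u l - horiz_at u (l + 1)\<bar> = 1"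
    using ribbon.horiz_at_step[OF t(3)] ribbon.horiz_at_step[OF u(3)] t(2) u(2) assms by auto
  moreover have "even (horiz_at t l) \<longleftrightarrow> even (horiz_at u l)"
    using ribbon.parity[OF t(3)] ribbon.parity[OF u(3)] t(2) u(2) assms by auto
  ultimately show ?thesis using assms(5) by presburger
qed

lemma horiz_at_less_iff:
  assumes tu: "t \<in> tiles_of_level \<alpha> c" "u \<in> tiles_of_level \<alpha> c" and l: "c \<le> l" "l < c + int n"
  shows "horiz_at t l < horiz_at u l \<longleftrightarrow> horiz_at t c < horiz_at u c"
  using l
proof (induction l rule: int_ge_induct)
  case (step l)
  show ?case
  proof (cases "t = u")
    case False
    then have "horiz_at t l \<noteq> horiz_at u l" using step by (intro horiz_at_neq[OF tu]) auto
    then show ?thesis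
      using step horiz_at_less_step[OF tu, of l] horiz_at_less_step[OF tu(2,1), of l] by fastforce
  qed auto
qed auto

text \<open>A witness pair may lie on neighbouring levels. Moving to a common level shifts one
  position by 1, which gives at worst equality, and that is excluded by disjointness.\<close>

lemma tile_left_iff:
  assumes tu: "t \<in> tiles_of_level \<alpha> c" "u \<in> tiles_of_level \<alpha> c" and l: "c \<le> l" "l < c + int n"
  shows "tile_left t u \<longleftrightarrow> horiz_at t l < horiz_at u l"
proof
  note t = tiles_of_levelD[OF tu(1)] and u = tiles_of_levelD[OF tu(2)]
  assume "horiz_at t l < horiz_at u l"
  then have "square_left (tile_square t l) (tile_square u l)"
    using l t u by (simp add: square_left_iff horiz_at_def ribbon.tile_square)
  moreover have "t \<noteq> u" using \<open>horiz_at t l < horiz_at u l\<close> by auto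
  ultimately show "tile_left t u"
    using l t u ribbon.tile_square(1) unfolding tile_left_def by metis
next
  note t = tiles_of_levelD[OF tu(1)] and u = tiles_of_levelD[OF tu(2)]
  assume "tile_left t u"
  then obtain s1 s2 where s: "t \<noteq> u" "s1 \<in> t" "s2 \<in> u" "\<bar>level s1 - level s2\<bar> \<le> 1" "horiz s1 < horiz s2"
    by (auto simp: tile_left_def square_left_iff)
  have b: "c \<le> level s1" "level s1 < c + int n" "c \<le> level s2" "level s2 < c + int n"
    using ribbon.level_bounds[OF t(3) s(2)] ribbon.level_bounds[OF u(3) s(3)] t u by auto
  have h: "horiz_at t (level s1) = horiz s1" "horiz_at u (level s2) = horiz s2"
    using ribbon.tile_square_eq[OF t(3) s(2)] ribbon.tile_square_eq[OF u(3) s(3)]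
    by (simp_all add: horiz_at_def)
  have "horiz_at t (level s1) < horiz_at u (level s1)"
  proof (cases "level s1 = level s2")
    case True
    then show ?thesis using h s by simp
  next
    case False
    then have "level s2 = level s1 + 1 \<or> level s1 = level s2 + 1" using s(4) by linarith
    then have "\<bar>horiz_at u (level s1) - horiz_at u (level s2)\<bar> = 1"
      using ribbon.horiz_at_step[OF u(3), of "level s1"] ribbon.horiz_at_step[OF u(3), of "level s2"] b u(2)
      by (auto simp: abs_minus_commute)
    moreover have "horiz_at t (level s1) \<noteq> horiz_at u (level s1)"
      using b horiz_at_neq[OF tu s(1)] by blast
    moreover have "even (horiz_at t (level s1)) \<longleftrightarrow> even (horiz_at u (level s1))"
      using ribbon.parity[OF t(3)] ribbon.parity[OF u(3)] t(2) u(2) b by auto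
    ultimately show ?thesis using s(5) h by presburger
  qed
  then show "horiz_at t l < horiz_at u l"
    using horiz_at_less_iff[OF tu] l b by blast
qed

lemma is_nth_tile_iff:
  assumes "c \<le> l" "l < c + int n"
  shows "is_nth_tile \<alpha> c i t \<longleftrightarrow> t \<in> tiles_of_level \<alpha> c \<and> left_count \<alpha> c l (horiz_at t l) + 1 = i"
proof -
  have "{u \<in> tiles_of_level \<alpha> c. tile_left u t} = {u \<in> tiles_of_level \<alpha> c. horiz_at u l < horiz_at t l}"
    if "t \<in> tiles_of_level \<alpha> c"
    by (intro Collect_cong conj_cong refl) (rule tile_left_iff[OF _ that assms])
  then show ?thesis
    unfolding is_nth_tile_def left_count_def by (cases "t \<in> tiles_of_level \<alpha> c") simp_all
qed

lemma rank_bij: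
  assumes "c \<le> l" "l < c + int n"
  shows "bij_betw (\<lambda>t. left_count \<alpha> c l (horiz_at t l)) (tiles_of_level \<alpha> c) {..<card (tiles_of_level \<alpha> c)}"
  unfolding left_count_def
proof (rule card_rank_image)
  show "inj_on (\<lambda>t. horiz_at t l) (tiles_of_level \<alpha> c)"
    using horiz_at_neq assms by (intro inj_onI) blast
qed simp

lemma nth_tile_defined_iff:
  "nth_tile_defined \<alpha> c i \<longleftrightarrow> 1 \<le> i \<and> i \<le> card (tiles_of_level \<alpha> c)"
proof -
  have l: "c \<le> c" "c < c + int n" using n by auto
  have "nth_tile_defined \<alpha> c i \<longleftrightarrow> (\<exists>m\<in>{..<card (tiles_of_level \<alpha> c)}. m + 1 = i)"
    unfolding nth_tile_defined_def is_nth_tile_iff[OF l]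
    unfolding bij_betw_imp_surj_on[OF rank_bij[OF l], symmetric] by blast
  also have "\<dots> \<longleftrightarrow> 1 \<le> i \<and> i \<le> card (tiles_of_level \<alpha> c)"
    by (auto intro: bexI[of _ "i - 1"])
  finally show ?thesis .
qed

lemma is_nth_tile_nth_tile:
  assumes "nth_tile_defined \<alpha> c i"
  shows "is_nth_tile \<alpha> c i (nth_tile \<alpha> c i)"
  unfolding nth_tile_def
proof (rule theI')
  have l: "c \<le> c" "c < c + int n" using n by auto
  show "\<exists>!t. is_nth_tile \<alpha> c i t"
    using assms bij_betw_imp_inj_on[OF rank_bij[OF l]]
    unfolding nth_tile_defined_def is_nth_tile_iff[OF l] by (auto dest: inj_onD)
qed

text \<open>By the last claim, the position of the \<open>i\<close>-th tile relative to
  \<open>p\<close> is known from a left count alone.\<close>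

lemma nth_tile:
  assumes "nth_tile_defined \<alpha> c i"
  shows "nth_tile \<alpha> c i \<in> tiles_of_level \<alpha> c"
    and "c \<le> l \<Longrightarrow> l < c + int n \<Longrightarrow> left_count \<alpha> c l (horiz_at (nth_tile \<alpha> c i) l) + 1 = i"
    and "c \<le> l \<Longrightarrow> l < c + int n \<Longrightarrow> horiz_at (nth_tile \<alpha> c i) l < p \<longleftrightarrow> i \<le> left_count \<alpha> c l p"
proof -
  have l: "c \<le> c" "c < c + int n" using n by auto
  show t: "nth_tile \<alpha> c i \<in> tiles_of_level \<alpha> c"
    using is_nth_tile_nth_tile[OF assms] is_nth_tile_iff[OF l] by blast
  show r: "left_count \<alpha> c l (horiz_at (nth_tile \<alpha> c i) l) + 1 = i" if "c \<le> l" "l < c + int n"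
    using is_nth_tile_nth_tile[OF assms] is_nth_tile_iff[OF that] by blast
  show "horiz_at (nth_tile \<alpha> c i) l < p \<longleftrightarrow> i \<le> left_count \<alpha> c l p" if "c \<le> l" "l < c + int n"
    using card_rank_less_iff[OF _ t, of "\<lambda>t. horiz_at t l" p] r[OF that]
    by (auto simp: left_count_def)
qed

section \<open>Counting squares by tiles, and the balance across a strip\<close>

lemma left_squares_eq:
  "left_squares R l p = card {t \<in> \<alpha>. \<exists>s\<in>t. level s = l \<and> horiz s < p}"
proof -
  have "bij_betw (\<lambda>t. tile_square t l) {t \<in> \<alpha>. \<exists>s\<in>t. level s = l \<and> horiz s < p}
      {s \<in> R. level s = l \<and> horiz s < p}"
    unfolding bij_betw_def
  proof
    show "inj_on (\<lambda>t. tile_square t l) {t \<in> \<alpha>. \<exists>s\<in>t. level s = l \<and> horiz s < p}"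
    proof (rule inj_onI, clarify)
      fix t u s s'
      assume "t \<in> \<alpha>" "u \<in> \<alpha>" "s \<in> t" "s' \<in> u" "l = level s" "level s' = level s"
        "tile_square t (level s) = tile_square u (level s)"
      then have "s = s'" using ribbon.tile_square_eq ribbon by metis
      then show "t = u" using tile_unique \<open>t \<in> \<alpha>\<close> \<open>u \<in> \<alpha>\<close> \<open>s \<in> t\<close> \<open>s' \<in> u\<close> by blast
    qed
    have eq: "tile_square t (level s) = s" if "t \<in> \<alpha>" "s \<in> t" for s t
      using that ribbon ribbon.tile_square_eq by blast
    show "(\<lambda>t. tile_square t l) ` {t \<in> \<alpha>. \<exists>s\<in>t. level s = l \<and> horiz s < p}
        = {s \<in> R. level s = l \<and> horiz s < p}"
    proof (intro equalityI subsetI)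
      fix s assume "s \<in> {s \<in> R. level s = l \<and> horiz s < p}"
      moreover from this obtain t where "t \<in> \<alpha>" "s \<in> t" using tile_exists by blast
      ultimately show "s \<in> (\<lambda>t. tile_square t l) ` {t \<in> \<alpha>. \<exists>s\<in>t. level s = l \<and> horiz s < p}"
        using eq[of t s] by (intro image_eqI[of _ _ t]) auto
    next
      fix s' assume "s' \<in> (\<lambda>t. tile_square t l) ` {t \<in> \<alpha>. \<exists>s\<in>t. level s = l \<and> horiz s < p}"
      then obtain t s where "s' = tile_square t l" "t \<in> \<alpha>" "s \<in> t" "level s = l" "horiz s < p"
        by blast
      then show "s' \<in> {s \<in> R. level s = l \<and> horiz s < p}"
        using eq[of t s] tile_subset[of t] by auto
    qed
  qed
  then show ?thesis by (simp add: left_squares_def bij_betw_same_card)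
qed

lemma left_count_eq:
  assumes "c \<le> l" "l < c + int n"
  shows "left_count \<alpha> c l p = card {t \<in> tiles_of_level \<alpha> c. \<exists>s\<in>t. level s = l \<and> horiz s < p}"
proof -
  have "horiz_at t l < p \<longleftrightarrow> (\<exists>s\<in>t. level s = l \<and> horiz s < p)" if "t \<in> tiles_of_level \<alpha> c" for t
    using tiles_of_levelD[OF that] assms ribbon.tile_square[of n t l] ribbon.tile_square_eq[of n t]
    unfolding horiz_at_def by metis
  then show ?thesis unfolding left_count_def
    by (intro arg_cong[of _ _ card] Collect_cong conj_cong refl)
qed

text \<open>No domino cut out by a tile from the strip of levels \<open>k\<close> and
  \<open>k + 1\<close> straddles \<open>p\<close>.\<close>

definition cut :: "int \<Rightarrow> int \<Rightarrow> bool" where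
  "cut k p \<longleftrightarrow> (\<forall>t\<in>\<alpha>. \<forall>s\<in>t. \<forall>s'\<in>t. level s = k \<longrightarrow> level s' = k + 1 \<longrightarrow> (horiz s < p \<longleftrightarrow> horiz s' < p))"

text \<open>By \<open>side\<close>, a tile avoiding \<open>b\<close> passes it on one side, so only
  a tile through \<open>b\<close> could straddle its position.\<close>

lemma cutI:
  assumes b: "level b = k \<or> level b = k + 1"
    and free: "\<And>t s s'. t \<in> \<alpha> \<Longrightarrow> b \<in> t \<Longrightarrow> s \<in> t \<Longrightarrow> s' \<in> t \<Longrightarrow> level s = k \<Longrightarrow> level s' = k + 1 \<Longrightarrow> False"
  shows "cut k (horiz b)"
  unfolding cut_def
proof (intro ballI impI)
  fix t s s' assume t: "t \<in> \<alpha>" and s: "s \<in> t" "s' \<in> t" "level s = k" "level s' = k + 1"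
  then have "b \<notin> t" using free by blast
  then show "horiz s < horiz b \<longleftrightarrow> horiz s' < horiz b"
    using ribbon.side(1)[OF ribbon[OF t] \<open>b \<notin> t\<close> s(1) _ s(2)] s b by auto
qed

text \<open>The tiles meeting both levels contribute the same to the left part of either level.\<close>

lemma balance:
  assumes "cut k p"
  shows "left_squares R (k + 1) p + left_count \<alpha> (k - int n + 1) k p
       = left_squares R k p + left_count \<alpha> (k + 1) (k + 1) p"
proof -
  define T where "T l = {t \<in> \<alpha>. \<exists>s\<in>t. level s = l \<and> horiz s < p}" for l
  define E where "E c l = {t \<in> tiles_of_level \<alpha> c. \<exists>s\<in>t. level s = l \<and> horiz s < p}" for c l
  have fin: "finite (T l)" "finite (E c l)" for c l by (simp_all add: T_def E_def)
  have lev: "tile_level t \<le> l \<and> l < tile_level t + int n \<longleftrightarrow> (\<exists>s\<in>t. level s = l)" if "t \<in> \<alpha>" for t l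
    using ribbon.levels[OF ribbon[OF that]] by (metis atLeastLessThan_iff image_iff)
  \<comment> \<open>A tile counted on level \<open>k\<close> either continues to level
    \<open>k + 1\<close>, where the cut makes it counted too, or has its top on level
    \<open>k\<close>. Dually, one counted on level \<open>k + 1\<close> comes from level
    \<open>k\<close> or starts there.\<close>
  have 1: "T k = (T k \<inter> T (k + 1)) \<union> E (k - int n + 1) k"
  proof (intro equalityI subsetI)
    fix t assume t: "t \<in> T k"
    show "t \<in> (T k \<inter> T (k + 1)) \<union> E (k - int n + 1) k"
    proof (cases "\<exists>s\<in>t. level s = k + 1")
      case True
      then show ?thesis using t assms unfolding T_def cut_def by blast
    next
      case False
      then have "tile_level t = k - int n + 1"
        using t lev[of t k] lev[of t "k + 1"] unfolding T_def by force
      then show ?thesis using t by (auto simp: T_def E_def tiles_of_level_def)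
    qed
  qed (auto simp: T_def E_def tiles_of_level_def)
  have 2: "T (k + 1) = (T k \<inter> T (k + 1)) \<union> E (k + 1) (k + 1)"
  proof (intro equalityI subsetI)
    fix t assume t: "t \<in> T (k + 1)"
    show "t \<in> (T k \<inter> T (k + 1)) \<union> E (k + 1) (k + 1)"
    proof (cases "\<exists>s\<in>t. level s = k")
      case True
      then show ?thesis using t assms unfolding T_def cut_def by blast
    next
      case False
      then have "tile_level t = k + 1"
        using t lev[of t k] lev[of t "k + 1"] unfolding T_def by force
      then show ?thesis using t by (auto simp: T_def E_def tiles_of_level_def)
    qed
  qed (auto simp: T_def E_def tiles_of_level_def)
  have "T (k + 1) \<inter> E (k - int n + 1) k = {}"
  proof (rule equals0I)
    fix t assume "t \<in> T (k + 1) \<inter> E (k - int n + 1) k"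
    then show False using lev[of t "k + 1"] by (auto simp: T_def E_def tiles_of_level_def)
  qed
  then have "card (T k) = card (T k \<inter> T (k + 1)) + card (E (k - int n + 1) k)"
    using fin by (subst 1) (auto intro!: card_Un_disjoint)
  moreover have "T k \<inter> E (k + 1) (k + 1) = {}"
  proof (rule equals0I)
    fix t assume "t \<in> T k \<inter> E (k + 1) (k + 1)"
    then show False using lev[of t k] by (auto simp: T_def E_def tiles_of_level_def)
  qed
  then have "card (T (k + 1)) = card (T k \<inter> T (k + 1)) + card (E (k + 1) (k + 1))"
    using fin by (subst 2) (auto intro!: card_Un_disjoint)
  ultimately show ?thesis
    using n by (simp add: left_squares_eq left_count_eq T_def E_def)
qed

section \<open>Tiles seen from a square outside the region\<close>

lemma tile_left_square_iff:
  assumes t: "t \<in> tiles_of_level \<alpha> c" and b: "b \<notin> R"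
    and l: "c \<le> l" "l < c + int n" "\<bar>l - level b\<bar> \<le> 1"
  shows "tile_left_square t b \<longleftrightarrow> horiz_at t l < horiz b"
    and "square_left_tile b t \<longleftrightarrow> \<not> horiz_at t l < horiz b"
proof -
  note t' = tiles_of_levelD[OF t]
  have bt: "b \<notin> t" using b tile_subset[OF t'(1)] by blast
  have m: "tile_square t l \<in> t" "level (tile_square t l) = l"
    using ribbon.tile_square[OF t'(3)] l t'(2) by auto
  note side = ribbon.side[OF t'(3) bt _ _ m(1), unfolded m(2), folded horiz_at_def]
  show "tile_left_square t b \<longleftrightarrow> horiz_at t l < horiz b"
    unfolding tile_left_square_def square_left_iff using side(1) l(3) m
    by (metis horiz_at_def)
  show "square_left_tile b t \<longleftrightarrow> \<not> horiz_at t l < horiz b"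
    unfolding square_left_tile_def square_left_iff using side l(3) m
    by (smt (verit, best) horiz_at_def)
qed

lemma left_tiles_eq:
  assumes "b \<notin> R" "c \<le> l" "l < c + int n" "\<bar>l - level b\<bar> \<le> 1"
  shows "left_tiles \<alpha> c b = left_count \<alpha> c l (horiz b)"
  unfolding left_tiles_def left_count_def
  by (intro arg_cong[of _ _ card] Collect_cong conj_cong refl) (rule tile_left_square_iff(1)[OF _ assms])

lemma no_touch:
  assumes t: "t \<in> tiles_of_level \<alpha> c" and "level b + 1 < c \<or> c + int n < level b"
  shows "\<not> tile_left_square t b" "\<not> square_left_tile b t"
  using ribbon.level_bounds[OF tiles_of_levelD(3)[OF t]] tiles_of_levelD(2)[OF t] assms(2)
  unfolding tile_left_square_def square_left_tile_def square_left_iff by force+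

lemma left_tiles_far:
  assumes "level b + 1 < c \<or> c + int n < level b"
  shows "left_tiles \<alpha> c b = 0"
proof -
  have "{t \<in> tiles_of_level \<alpha> c. tile_left_square t b} = {}"
    using no_touch(1)[OF _ assms] by blast
  then show ?thesis by (simp add: left_tiles_def)
qed

text \<open>A square in no tile cuts both strips containing its level.\<close>

lemma left_tiles_balance:
  assumes "b \<notin> R" "level b = k \<or> level b = k + 1"
  shows "left_squares R (k + 1) (horiz b) + left_tiles \<alpha> (k - int n + 1) b
       = left_squares R k (horiz b) + left_tiles \<alpha> (k + 1) b"
proof -
  have "cut k (horiz b)"
    using assms tile_subset by (intro cutI) auto
  from balance[OF this] show ?thesis
    using left_tiles_eq[of b "k - int n + 1" k] left_tiles_eq[of b "k + 1" "k + 1"] assms n by auto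
qed

lemma horiz_at_in:
  assumes "t \<in> tiles_of_level \<alpha> c" "c \<le> l" "l < c + int n"
  obtains s where "s \<in> t" "s \<in> R" "level s = l" "horiz_at t l = horiz s"
proof (rule that)
  note t = tiles_of_levelD[OF assms(1)]
  show "tile_square t l \<in> t" "level (tile_square t l) = l"
    using ribbon.tile_square[OF t(3), of l] t(2) assms by auto
  then show "tile_square t l \<in> R" using tile_subset[OF t(1)] by blast
qed (simp add: horiz_at_def)

lemma left_count_all:
  assumes "c \<le> l" "l < c + int n" "\<And>s. s \<in> R \<Longrightarrow> level s = l \<Longrightarrow> horiz s < p"
  shows "left_count \<alpha> c l p = card (tiles_of_level \<alpha> c)"
proof -
  have "horiz_at t l < p" if "t \<in> tiles_of_level \<alpha> c" for t
    using horiz_at_in[OF that assms(1,2)] assms(3) by metis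
  then have "{t \<in> tiles_of_level \<alpha> c. horiz_at t l < p} = tiles_of_level \<alpha> c" by blast
  then show ?thesis by (simp add: left_count_def)
qed

lemma left_count_none:
  assumes "c \<le> l" "l < c + int n" "\<And>s. s \<in> R \<Longrightarrow> level s = l \<Longrightarrow> \<not> horiz s < p"
  shows "left_count \<alpha> c l p = 0"
proof -
  have "\<not> horiz_at t l < p" if "t \<in> tiles_of_level \<alpha> c" for t
    using horiz_at_in[OF that assms(1,2)] assms(3) by metis
  then have "{t \<in> tiles_of_level \<alpha> c. horiz_at t l < p} = {}" by blast
  then show ?thesis by (simp only: left_count_def card.empty)
qed

section \<open>Tiles whose levels differ by \<open>n\<close>\<close>

text \<open>Only the top of \<open>t\<close> and the bottom of \<open>u\<close> are on levels close
  enough to compare, and their positions have different parity.\<close>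

lemma tile_left_next:
  assumes t: "t \<in> tiles_of_level \<alpha> c" and u: "u \<in> tiles_of_level \<alpha> (c + int n)"
  shows "tile_left t u \<longleftrightarrow> \<not> horiz_at u (c + int n) < horiz_at t (c + int n - 1)"
    and "tile_left u t \<longleftrightarrow> horiz_at u (c + int n) < horiz_at t (c + int n - 1)"
proof -
  let ?k = "c + int n - 1"
  note t' = tiles_of_levelD[OF t] and u' = tiles_of_levelD[OF u]
  have ts: "tile_square t ?k \<in> t" "level (tile_square t ?k) = ?k"
    using ribbon.tile_square[OF t'(3), of ?k] t'(2) n by auto
  have us: "tile_square u (c + int n) \<in> u" "level (tile_square u (c + int n)) = c + int n"
    using ribbon.tile_square[OF u'(3), of "c + int n"] u'(2) n by auto
  have "t \<noteq> u" using t'(2) u'(2) n by auto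
  have only: "v = tile_square t ?k \<and> w = tile_square u (c + int n)"
    if "v \<in> t" "w \<in> u" "\<bar>level v - level w\<bar> \<le> 1" for v w
  proof -
    have "level v = ?k" "level w = c + int n"
      using ribbon.level_bounds[OF t'(3) that(1)] ribbon.level_bounds[OF u'(3) that(2)] that(3) t'(2) u'(2)
      by linarith+
    then show ?thesis
      using ribbon.tile_square_eq[OF t'(3) that(1)] ribbon.tile_square_eq[OF u'(3) that(2)] by simp
  qed
  have ne: "horiz_at u (c + int n) \<noteq> horiz_at t ?k"
    using ribbon.parity[OF t'(3), of ?k] ribbon.parity[OF u'(3), of "c + int n"] t'(2) u'(2) n
    by fastforce
  have "tile_left t u \<longleftrightarrow> horiz_at t ?k < horiz_at u (c + int n)"
  proof
    assume "tile_left t u"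
    then obtain v w where "v \<in> t" "w \<in> u" "\<bar>level v - level w\<bar> \<le> 1" "horiz v < horiz w"
      by (auto simp: tile_left_def square_left_iff)
    then show "horiz_at t ?k < horiz_at u (c + int n)"
      using only unfolding horiz_at_def by blast
  next
    assume "horiz_at t ?k < horiz_at u (c + int n)"
    then have "square_left (tile_square t ?k) (tile_square u (c + int n))"
      using ts us by (simp add: square_left_iff horiz_at_def)
    then show "tile_left t u" using ts us \<open>t \<noteq> u\<close> unfolding tile_left_def by blast
  qed
  then show "tile_left t u \<longleftrightarrow> \<not> horiz_at u (c + int n) < horiz_at t ?k"
    using ne by linarith
  show "tile_left u t \<longleftrightarrow> horiz_at u (c + int n) < horiz_at t ?k"
  proof
    assume "tile_left u t"
    then obtain w v where "v \<in> t" "w \<in> u" "\<bar>level w - level v\<bar> \<le> 1" "horiz w < horiz v"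
      by (auto simp: tile_left_def square_left_iff)
    then show "horiz_at u (c + int n) < horiz_at t ?k"
      using only[of v w] unfolding horiz_at_def by (simp add: abs_minus_commute)
  next
    assume "horiz_at u (c + int n) < horiz_at t ?k"
    then have "square_left (tile_square u (c + int n)) (tile_square t ?k)"
      using ts us by (simp add: square_left_iff horiz_at_def)
    then show "tile_left u t" using ts us \<open>t \<noteq> u\<close> unfolding tile_left_def by blast
  qed
qed

lemma tile_left_levels:
  assumes t: "t \<in> tiles_of_level \<alpha> c" and u: "u \<in> tiles_of_level \<alpha> d" and "tile_left t u"
  shows "\<bar>c - d\<bar> \<le> int n"
proof -
  note t' = tiles_of_levelD[OF t] and u' = tiles_of_levelD[OF u]
  obtain v w where vw: "v \<in> t" "w \<in> u" "\<bar>level v - level w\<bar> \<le> 1"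
    using assms(3) by (auto simp: tile_left_def square_left_iff)
  show ?thesis
    using ribbon.level_bounds[OF t'(3) vw(1)] ribbon.level_bounds[OF u'(3) vw(2)] vw(3) t'(2) u'(2)
    by linarith
qed

text \<open>The tile through this position ends on level \<open>c + int n - 1\<close>, so its top
  cuts the strip above.\<close>

lemma top_balance:
  assumes t: "t \<in> tiles_of_level \<alpha> c" and p: "p = horiz_at t (c + int n - 1)"
  shows "left_squares R (c + int n) p + left_count \<alpha> c (c + int n - 1) p
       = left_squares R (c + int n - 1) p + left_count \<alpha> (c + int n) (c + int n) p"
proof -
  let ?k = "c + int n - 1"
  note t' = tiles_of_levelD[OF t]
  have ts: "tile_square t ?k \<in> t" "level (tile_square t ?k) = ?k"
    using ribbon.tile_square[OF t'(3), of ?k] t'(2) n by auto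
  have "cut ?k (horiz (tile_square t ?k))"
  proof (rule cutI)
    fix u s s' assume u: "u \<in> \<alpha>" "tile_square t ?k \<in> u" "s' \<in> u" "level s' = ?k + 1"
    then have "s' \<in> t" using tile_unique[OF t'(1) u(1) ts(1)] by blast
    then show False using ribbon.level_bounds[OF t'(3), of s'] t'(2) u(4) by simp
  qed (use ts in simp)
  from balance[OF this] show ?thesis by (simp add: p horiz_at_def)
qed

end

lemma left_squares_Un:
  assumes "finite R" "p \<le> q"
  shows "left_squares R l q = left_squares R l p + card {s \<in> R. level s = l \<and> p \<le> horiz s \<and> horiz s < q}"
  unfolding left_squares_def using assms
  by (subst card_Un_disjoint[symmetric]) (auto intro!: arg_cong[of _ _ card])

text \<open>Between two positions of the parity of \<open>k\<close>, a full strip has equally many squares on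
  levels \<open>k\<close> and \<open>k + 1\<close>.\<close>

lemma full_strip:
  assumes fin: "finite R" and "p \<le> q" and par: "even p \<longleftrightarrow> even k" "even q \<longleftrightarrow> even k"
    and full: "\<And>s. level s = k \<or> level s = k + 1 \<Longrightarrow> p \<le> horiz s \<Longrightarrow> horiz s < q \<Longrightarrow> s \<in> R"
  shows "left_squares R k q + left_squares R (k + 1) p = left_squares R k p + left_squares R (k + 1) q"
proof -
  let ?S = "\<lambda>l. {s \<in> R. level s = l \<and> p \<le> horiz s \<and> horiz s < q}"
  \<comment> \<open>A move to the right raises \<open>level\<close> and \<open>horiz\<close> by 1.
    By parity, level \<open>k\<close> avoids position \<open>q - 1\<close> and level
    \<open>k + 1\<close> avoids position \<open>p\<close>, so moves in either direction stay in the
    range.\<close>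
  have "bij_betw (\<lambda>s. (fst s + 1, snd s)) (?S k) (?S (k + 1))"
  proof (rule bij_betw_byWitness[where f' = "\<lambda>s. (fst s - 1, snd s)"])
    have h: "level (fst s + i, snd s) = level s + i" "horiz (fst s + i, snd s) = horiz s + i" for s :: square and i
      by (simp_all add: level_def horiz_def)
    have ne: "horiz s \<noteq> q - 1" if "level s = k" for s
      using that par even_horiz_iff[of s] by presburger
    have ne': "horiz s \<noteq> p" if "level s = k + 1" for s
      using that par even_horiz_iff[of s] by presburger
    show "(\<lambda>s. (fst s + 1, snd s)) ` ?S k \<subseteq> ?S (k + 1)"
    proof (rule image_subsetI)
      fix s assume "s \<in> ?S k"
      then show "(fst s + 1, snd s) \<in> ?S (k + 1)"
        using h[of s 1] ne[of s] full[of "(fst s + 1, snd s)"] by auto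
    qed
    show "(\<lambda>s. (fst s - 1, snd s)) ` ?S (k + 1) \<subseteq> ?S k"
    proof (rule image_subsetI)
      fix s assume "s \<in> ?S (k + 1)"
      then show "(fst s - 1, snd s) \<in> ?S k"
        using h[of s "-1"] ne'[of s] full[of "(fst s - 1, snd s)"] by auto
    qed
  qed auto
  then have "card (?S k) = card (?S (k + 1))" by (rule bij_betw_same_card)
  then show ?thesis
    using left_squares_Un[OF fin \<open>p \<le> q\<close>] by simp
qed

section \<open>Comparing two tilings\<close>

locale two_tilings = A: ribbon_tiled n R \<alpha> + B: ribbon_tiled n R \<beta> for n R \<alpha> \<beta>
begin

text \<open>To the right of all of \<open>R\<close> the balance is a recursion from level
  \<open>c - int n\<close> to level \<open>c\<close> whose other terms depend on \<open>R\<close>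
  only; below \<open>R\<close> there are no tiles.\<close>

lemma card_tiles_of_level_eq: "card (tiles_of_level \<alpha> c) = card (tiles_of_level \<beta> c)"
proof -
  obtain P where P: "\<And>s. s \<in> R \<Longrightarrow> horiz s < P"
  proof -
    have "finite (horiz ` R)" using A.fin by simp
    then show ?thesis using that[of "Max (horiz ` R) + 1"] by (simp add: le_imp_less_Suc Max_ge zle_add1_eq_le)
  qed
  obtain L where L: "\<And>s. s \<in> R \<Longrightarrow> L \<le> level s"
  proof -
    have "finite (level ` R)" using A.fin by simp
    then show ?thesis using that[of "Min (level ` R)"] by simp
  qed
  have low: "card (tiles_of_level \<gamma> c) = 0" if "ribbon_tiled n R \<gamma>" "c < L" for \<gamma> c
  proof -
    interpret ribbon_tiled n R \<gamma> by fact
    have False if t: "t \<in> tiles_of_level \<gamma> c" for t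
      by (rule horiz_at_in[OF t, of c]) (use n L \<open>c < L\<close> in force)+
    then show ?thesis by auto
  qed
  have step: "left_squares R c P + card (tiles_of_level \<gamma> (c - int n))
      = left_squares R (c - 1) P + card (tiles_of_level \<gamma> c)" if "ribbon_tiled n R \<gamma>" for \<gamma> c
  proof -
    interpret ribbon_tiled n R \<gamma> by fact
    have "cut (c - 1) P" unfolding cut_def using tile_subset P by blast
    from balance[OF this] show ?thesis
      using left_count_all[of "c - int n" "c - 1" P] left_count_all[of c c P] P n by simp
  qed
  show ?thesis
  \<comment> \<open>The \<open>+ 1\<close> keeps the measure positive at \<open>c = L\<close>, so
    that passing to \<open>c - int n\<close> decreases it there too.\<close>
  proof (induction "nat (c - L + 1)" arbitrary: c rule: less_induct)
    case less
    show ?case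
    proof (cases "c < L")
      case True
      then show ?thesis using low A.ribbon_tiled_axioms B.ribbon_tiled_axioms by simp
    next
      case False
      then have "card (tiles_of_level \<alpha> (c - int n)) = card (tiles_of_level \<beta> (c - int n))"
        using A.n by (intro less) auto
      then show ?thesis
        using step[OF A.ribbon_tiled_axioms, of c] step[OF B.ribbon_tiled_axioms, of c] by simp
    qed
  qed
qed

lemma nth_tile_defined_eq: "nth_tile_defined \<alpha> c i \<longleftrightarrow> nth_tile_defined \<beta> c i"
  by (simp add: A.nth_tile_defined_iff B.nth_tile_defined_iff card_tiles_of_level_eq)

section \<open>Agreement of two tilings at squares outside the region\<close>

definition agree :: "square \<Rightarrow> bool" where
  "agree b \<longleftrightarrow> (\<forall>c. left_tiles \<alpha> c b = left_tiles \<beta> c b)"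

text \<open>The \<open>n\<close> tile levels meeting level \<open>l\<close> represent all residues; the balance equations across
  the two strips next to \<open>b\<close> carry agreement from them to every other level.\<close>

lemma agreeI:
  assumes b: "b \<notin> R" and l: "\<bar>l - level b\<bar> \<le> 1"
    and window: "\<And>c. c \<le> l \<Longrightarrow> l < c + int n \<Longrightarrow> left_count \<alpha> c l (horiz b) = left_count \<beta> c l (horiz b)"
  shows "agree b"
  unfolding agree_def
proof
  fix c
  define E where "E c \<longleftrightarrow> left_tiles \<alpha> c b = left_tiles \<beta> c b" for c
  define k where "k = level b"
  have w: "E c" if "c \<le> l" "l < c + int n" for c
    using window[OF that] A.left_tiles_eq[OF b that l] B.left_tiles_eq[OF b that l] by (simp add: E_def)
  have up: "E (k - int n + 1) \<longleftrightarrow> E (k + 1)"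
    using A.left_tiles_balance[OF b, of k] B.left_tiles_balance[OF b, of k] by (auto simp: E_def k_def)
  have down: "E (k - int n) \<longleftrightarrow> E k"
    using A.left_tiles_balance[OF b, of "k - 1"] B.left_tiles_balance[OF b, of "k - 1"]
    by (auto simp: E_def k_def)
  have far: "E c" if "k + 1 < c \<or> c + int n < k" for c
    using A.left_tiles_far B.left_tiles_far that by (simp add: E_def k_def)
  consider "l = k - 1" | "l = k" | "l = k + 1" using l k_def by linarith
  then have E: "E k \<and> E (k - int n + 1)"
  proof cases
    \<comment> \<open>The window at \<open>k - 1\<close> starts at \<open>k - int n\<close>, which
      is equivalent to \<open>k\<close>. It misses \<open>k - int n + 1\<close> only for
      \<open>n = 1\<close>, when that level is \<open>k\<close> itself.\<close>
    case 1
    have "E k" using w[of "k - int n"] down A.n 1 by auto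
    then show ?thesis using w[of "k - int n + 1"] A.n 1 by (cases "n = 1") auto
  next
    case 2
    then show ?thesis using w[of k] w[of "k - int n + 1"] A.n by auto
  next
    case 3
    have "E (k - int n + 1)" using w[of "k + 1"] up A.n 3 by auto
    then show ?thesis using w[of k] A.n 3 by (cases "n = 1") auto
  qed
  \<comment> \<open>Levels in the last case lie in the window for each of the three possible
    \<open>l\<close>.\<close>
  consider "k + 1 < c \<or> c + int n < k" | "c \<in> {k - int n, k - int n + 1, k, k + 1}"
    | "k - int n + 1 < c" "c < k"
    by force
  then have "E c"
  proof cases
    case 3
    then show ?thesis using w[of c] l by (simp add: k_def)
  qed (use E far up down in auto)
  then show "left_tiles \<alpha> c b = left_tiles \<beta> c b" by (simp add: E_def)
qed

text \<open>All king moves share such a level \<open>l\<close>, and no square of level \<open>l\<close> other than the two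
  endpoints separates them.\<close>

lemma agree_step:
  assumes b: "b \<notin> R" "b' \<notin> R" and king: "king_adjacent b b'" and "agree b"
  shows "agree b'"
proof -
  \<comment> \<open>A king move changes the level by at most 2, so the rounded mean is within 1 of
    both levels.\<close>
  define l where "l = (level b + level b') div 2"
  have king': "fst b' - fst b \<in> {-1, 0, 1}" "snd b' - snd b \<in> {-1, 0, 1}"
    using king by (auto simp: king_adjacent_def)
  have l: "\<bar>l - level b\<bar> \<le> 1" "\<bar>l - level b'\<bar> \<le> 1"
    using king' by (auto simp: l_def level_def)
  have between: "horiz s < horiz b \<longleftrightarrow> horiz s < horiz b'" if "s \<in> R" "level s = l" for s
  proof -
    have "fst s \<noteq> fst b \<or> snd s \<noteq> snd b" "fst s \<noteq> fst b' \<or> snd s \<noteq> snd b'"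
      using b that(1) prod_eqI by metis+
    moreover obtain x y where "fst b' = fst b + x" "snd b' = snd b + y" "x \<in> {-1, 0, 1}" "y \<in> {-1, 0, 1}"
      using king' by (metis add_diff_cancel_left' diff_add_cancel add.commute)
    ultimately show ?thesis
      using that(2) by (auto simp: l_def level_def horiz_def) presburger+
  qed
  have "left_count \<gamma> c l (horiz b) = left_count \<gamma> c l (horiz b')"
    if "ribbon_tiled n R \<gamma>" "c \<le> l" "l < c + int n" for \<gamma> c
  proof -
    have "horiz_at t l < horiz b \<longleftrightarrow> horiz_at t l < horiz b'" if "t \<in> tiles_of_level \<gamma> c" for t
      using ribbon_tiled.horiz_at_in[OF \<open>ribbon_tiled n R \<gamma>\<close> that \<open>c \<le> l\<close> \<open>l < c + int n\<close>] between by metis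
    then show ?thesis
      unfolding left_count_def by (intro arg_cong[of _ _ card] Collect_cong conj_cong refl)
  qed
  then have "left_count \<alpha> c l (horiz b') = left_count \<beta> c l (horiz b')" if "c \<le> l" "l < c + int n" for c
    using \<open>agree b\<close> A.left_tiles_eq[OF b(1) that l(1)] B.left_tiles_eq[OF b(1) that l(1)]
      A.ribbon_tiled_axioms B.ribbon_tiled_axioms that unfolding agree_def by metis
  then show ?thesis by (rule agreeI[OF b(2) l(2)])
qed

text \<open>An infinite set leaves any box around \<open>R\<close>. Outside the box, all squares of
  \<open>R\<close> on the level of \<open>b\<close> lie on one side of it, so each count is zero or
  complete.\<close>

lemma agree_far:
  assumes "infinite C" "C \<inter> R = {}"
  shows "\<exists>b\<in>C. agree b"
proof -
  define M where "M = Max (insert 0 ((\<lambda>s. \<bar>fst s\<bar> + \<bar>snd s\<bar>) ` R))"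
  have M: "\<bar>fst s\<bar> \<le> M \<and> \<bar>snd s\<bar> \<le> M" if "s \<in> R" for s
  proof -
    have "\<bar>fst s\<bar> + \<bar>snd s\<bar> \<le> M" unfolding M_def using A.fin that by (intro Max_ge) auto
    then show ?thesis by linarith
  qed
  have "\<not> C \<subseteq> {-M..M} \<times> {-M..M}"
    using assms(1) finite_subset by blast
  then obtain b where b: "b \<in> C" "fst b < -M \<or> snd b > M \<or> fst b > M \<or> snd b < -M"
    by (auto simp: subset_iff mem_Times_iff not_le)
  have "b \<notin> R" using b(1) assms(2) by blast
  have "agree b"
  proof (rule agreeI[OF \<open>b \<notin> R\<close>, of "level b"])
    fix c assume c: "c \<le> level b" "level b < c + int n"
    show "left_count \<alpha> c (level b) (horiz b) = left_count \<beta> c (level b) (horiz b)"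
    proof (cases "fst b < -M \<or> snd b > M")
      case True
      have "\<not> horiz s < horiz b" if "s \<in> R" "level s = level b" for s
        using M[OF that(1)] that(2) True unfolding level_def horiz_def by linarith
      then show ?thesis
        using A.left_count_none[OF c] B.left_count_none[OF c] by simp
    next
      case False
      then have "horiz s < horiz b" if "s \<in> R" "level s = level b" for s
        using M[OF that(1)] that(2) b(2) unfolding level_def horiz_def by linarith
      then show ?thesis
        using A.left_count_all[OF c] B.left_count_all[OF c] card_tiles_of_level_eq by simp
    qed
  qed simp
  then show ?thesis using b(1) by blast
qed

text \<open>The component of \<open>b\<close> contains a far square where the tilings agree, and
  king moves carry the agreement back to \<open>b\<close>.\<close>

lemma agree_complement:
  assumes "simply_connected_region R" "b \<notin> R"
  shows "agree b"
proof -
  let ?C = "complement_component R b"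
  have notR: "z \<notin> R" if "z \<in> ?C" for z
    using that assms(2) unfolding complement_component_def by (auto elim: rtranclE)
  then obtain z where z: "z \<in> ?C" "agree z"
    using agree_far[of ?C] infinite_complement_component[OF assms] by blast
  then have "(b, z) \<in> {(u, v). u \<notin> R \<and> v \<notin> R \<and> king_adjacent u v}\<^sup>*"
    by (simp add: complement_component_def)
  then show ?thesis using \<open>agree z\<close>
  proof (induction rule: rtrancl_induct)
    case (step y z)
    then have "king_adjacent z y" by (auto simp: king_adjacent_def abs_minus_commute)
    then show ?case using step agree_step[of z y] by auto
  qed
qed

text \<open>The top of a tile is never inside a domino crossing to the next level, so the balance equation
  holds at its position. A hole in the strip between the tops of the \<open>i\<close>-th tiles of the two tilings
  would see \<open>i\<close> tiles to its left in one tiling and fewer in the other.\<close>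

lemma next_rank_aux:
  assumes sc: "simply_connected_region R" and def: "nth_tile_defined \<alpha> c i"
    and le: "horiz_at (nth_tile \<alpha> c i) (c + int n - 1) \<le> horiz_at (nth_tile \<beta> c i) (c + int n - 1)"
  shows "left_count \<alpha> (c + int n) (c + int n) (horiz_at (nth_tile \<alpha> c i) (c + int n - 1))
       = left_count \<beta> (c + int n) (c + int n) (horiz_at (nth_tile \<beta> c i) (c + int n - 1))"
proof -
  define k where "k = c + int n - 1"
  have k: "c \<le> k" "k < c + int n" "k + 1 = c + int n" using A.n by (auto simp: k_def)
  define t u where "t = nth_tile \<alpha> c i" and "u = nth_tile \<beta> c i"
  define p q where "p = horiz_at t k" and "q = horiz_at u k"
  have def': "nth_tile_defined \<beta> c i" using def nth_tile_defined_eq by blast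
  have t: "t \<in> tiles_of_level \<alpha> c" and u: "u \<in> tiles_of_level \<beta> c"
    using A.nth_tile(1)[OF def] B.nth_tile(1)[OF def'] by (simp_all add: t_def u_def)
  obtain s where s: "s \<in> R" "level s = k" "p = horiz s"
    using A.horiz_at_in[OF t k(1,2)] p_def by metis
  obtain s' where s': "s' \<in> R" "level s' = k" "q = horiz s'"
    using B.horiz_at_in[OF u k(1,2)] q_def by metis
  have full: "b \<in> R" if b: "level b = k \<or> level b = k + 1" "p \<le> horiz b" "horiz b < q" for b
  proof (rule ccontr)
    assume "b \<notin> R"
    have near: "\<bar>k - level b\<bar> \<le> 1" using b(1) by auto
    have "left_count \<alpha> c k (horiz b) = left_count \<beta> c k (horiz b)"
      using agree_complement[OF sc \<open>b \<notin> R\<close>] A.left_tiles_eq[OF \<open>b \<notin> R\<close> k(1,2) near]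
        B.left_tiles_eq[OF \<open>b \<notin> R\<close> k(1,2) near] unfolding agree_def by metis
    moreover have "p \<noteq> horiz b"
    proof
      assume *: "p = horiz b"
      then have "even (level b) \<longleftrightarrow> even k" using s even_horiz_iff by metis
      then have "level b = k" using b(1) by auto
      then show False using * s \<open>b \<notin> R\<close> square_eqI by metis
    qed
    then have "i \<le> left_count \<alpha> c k (horiz b)"
      using A.nth_tile(3)[OF def k(1,2), of "horiz b"] b(2) by (simp add: p_def t_def)
    moreover have "\<not> i \<le> left_count \<beta> c k (horiz b)"
      using B.nth_tile(3)[OF def' k(1,2), of "horiz b"] b(3) by (simp add: q_def u_def)
    ultimately show False by simp
  qed
  have "left_squares R k q + left_squares R (k + 1) p = left_squares R k p + left_squares R (k + 1) q"
  proof (rule full_strip[OF A.fin _ _ _ full])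
    show "p \<le> q" using le by (simp add: p_def q_def t_def u_def k_def)
    show "even p \<longleftrightarrow> even k" "even q \<longleftrightarrow> even k"
      using s s' even_horiz_iff by metis+
  qed
  \<comment> \<open>Both counts are \<open>i - 1\<close>. The full strip gives equal differences of
    square counts at \<open>p\<close> and \<open>q\<close>, so the two balances leave equal counts
    on the next level.\<close>
  moreover have "left_count \<alpha> c k p = left_count \<beta> c k q"
    using A.nth_tile(2)[OF def k(1,2)] B.nth_tile(2)[OF def' k(1,2)] by (simp add: p_def q_def t_def u_def)
  moreover note A.top_balance[OF t, of p] B.top_balance[OF u, of q]
  ultimately show ?thesis
    using k(3) by (simp add: k_def[symmetric] t_def[symmetric] u_def[symmetric] p_def[symmetric] q_def[symmetric])
qed

text \<open>The tilings play symmetric roles, so either order of the two tops reduces to the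
  previous lemma.\<close>

lemma next_rank:
  assumes "simply_connected_region R" "nth_tile_defined \<alpha> c i"
  shows "left_count \<alpha> (c + int n) (c + int n) (horiz_at (nth_tile \<alpha> c i) (c + int n - 1))
       = left_count \<beta> (c + int n) (c + int n) (horiz_at (nth_tile \<beta> c i) (c + int n - 1))"
proof -
  interpret swap: two_tilings n R \<beta> \<alpha> ..
  show ?thesis
    using next_rank_aux[OF assms] swap.next_rank_aux[OF assms(1), of c i] assms(2)
      nth_tile_defined_eq by fastforce
qed

text \<open>Levels congruent modulo \<open>n\<close> are equal, one period apart, or too far apart
  for comparison. Equal levels compare \<open>i\<close> with \<open>j\<close>; one period apart, the
  index of the upper tile is compared with the count from \<open>next_rank\<close>.\<close>

lemma tile_left_eq:
  assumes sc: "simply_connected_region R" and cd: "c mod int n = d mod int n"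
    and def: "nth_tile_defined \<alpha> c i" "nth_tile_defined \<alpha> d j"
  shows "tile_left (nth_tile \<alpha> c i) (nth_tile \<alpha> d j) \<longleftrightarrow> tile_left (nth_tile \<beta> c i) (nth_tile \<beta> d j)"
proof -
  have def': "nth_tile_defined \<beta> c i" "nth_tile_defined \<beta> d j" using def nth_tile_defined_eq by blast+
  note A1 = A.nth_tile(1)[OF def(1)] and A2 = A.nth_tile(1)[OF def(2)]
  note B1 = B.nth_tile(1)[OF def'(1)] and B2 = B.nth_tile(1)[OF def'(2)]
  consider "d = c" | "d = c + int n" | "c = d + int n" | "\<bar>c - d\<bar> > int n"
  proof -
    have "int n dvd d - c" using cd by (metis mod_eq_dvd_iff)
    then obtain m where m: "d - c = int n * m" by blast
    consider "m = 0" | "m = 1" | "m = -1" | "\<bar>m\<bar> \<ge> 2" by linarith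
    then show thesis
    proof cases
      case 4
      then have "\<bar>c - d\<bar> \<ge> int n * 2"
        using m by (metis abs_minus_commute abs_mult abs_of_nat mult_left_mono of_nat_0_le_iff)
      then show thesis using that A.n by linarith
    qed (use that m in auto)
  qed
  then show ?thesis
  proof cases
    case 1
    have l: "c \<le> c" "c < c + int n" using A.n by auto
    show ?thesis
      using A.tile_left_iff[OF A1 A2[unfolded 1] l] B.tile_left_iff[OF B1 B2[unfolded 1] l]
        A.nth_tile(3)[OF def(1) l] B.nth_tile(3)[OF def'(1) l]
        A.nth_tile(2)[OF def(2)[unfolded 1] l] B.nth_tile(2)[OF def'(2)[unfolded 1] l] 1
      by (metis add_right_cancel)
  next
    case 2
    have l: "d \<le> d" "d < d + int n" using A.n by auto
    show ?thesis
      using A.tile_left_next(1)[OF A1 A2[unfolded 2]] B.tile_left_next(1)[OF B1 B2[unfolded 2]]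
        A.nth_tile(3)[OF def(2) l] B.nth_tile(3)[OF def'(2) l] next_rank[OF sc def(1)]
      by (simp add: 2)
  next
    case 3
    have l: "c \<le> c" "c < c + int n" using A.n by auto
    show ?thesis
      using A.tile_left_next(2)[OF A2 A1[unfolded 3]] B.tile_left_next(2)[OF B2 B1[unfolded 3]]
        A.nth_tile(3)[OF def(1) l] B.nth_tile(3)[OF def'(1) l] next_rank[OF sc def(2)]
      by (simp add: 3)
  next
    case 4
    then show ?thesis
      using A.tile_left_levels[OF A1 A2] B.tile_left_levels[OF B1 B2] by linarith
  qed
qed

text \<open>Agreement at \<open>b\<close> equates the left counts, and the \<open>i\<close>-th tile
  is left of \<open>b\<close> exactly if the count is at least \<open>i\<close>.\<close>

lemma tile_square_left_eq:
  assumes sc: "simply_connected_region R" and b: "b \<notin> R" and def: "nth_tile_defined \<alpha> c i"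
  shows "tile_left_square (nth_tile \<alpha> c i) b \<longleftrightarrow> tile_left_square (nth_tile \<beta> c i) b"
    and "square_left_tile b (nth_tile \<alpha> c i) \<longleftrightarrow> square_left_tile b (nth_tile \<beta> c i)"
proof -
  have def': "nth_tile_defined \<beta> c i" using def nth_tile_defined_eq by blast
  note A1 = A.nth_tile(1)[OF def] and B1 = B.nth_tile(1)[OF def']
  have "(tile_left_square (nth_tile \<alpha> c i) b \<longleftrightarrow> tile_left_square (nth_tile \<beta> c i) b) \<and>
    (square_left_tile b (nth_tile \<alpha> c i) \<longleftrightarrow> square_left_tile b (nth_tile \<beta> c i))"
  proof (cases "level b + 1 < c \<or> c + int n < level b")
    case True
    then show ?thesis using A.no_touch[OF A1] B.no_touch[OF B1] by blast
  next
    case False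
    then obtain l where l: "c \<le> l" "l < c + int n" "\<bar>l - level b\<bar> \<le> 1"
      \<comment> \<open>The level of the tile closest to that of \<open>b\<close>.\<close>
      using A.n that[of "max c (min (level b) (c + int n - 1))"] by fastforce
    have "left_count \<alpha> c l (horiz b) = left_count \<beta> c l (horiz b)"
      using agree_complement[OF sc b] A.left_tiles_eq[OF b l] B.left_tiles_eq[OF b l]
      unfolding agree_def by metis
    then show ?thesis
      using A.tile_left_square_iff[OF A1 b l] B.tile_left_square_iff[OF B1 b l]
        A.nth_tile(3)[OF def l(1,2)] B.nth_tile(3)[OF def' l(1,2)] by simp
  qed
  then show "tile_left_square (nth_tile \<alpha> c i) b \<longleftrightarrow> tile_left_square (nth_tile \<beta> c i) b"
    and "square_left_tile b (nth_tile \<alpha> c i) \<longleftrightarrow> square_left_tile b (nth_tile \<beta> c i)" by blast+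
qed

end

theorem lemma1p2:
  fixes n :: nat and R :: "square set" and \<alpha> \<beta> :: "square set set"
  assumes "n > 0"
    and "simply_connected_region R"
    and "ribbon_tiling n R \<alpha>"
    and "ribbon_tiling n R \<beta>"
  shows
    "((\<forall>c. card (tiles_of_level \<alpha> c) = card (tiles_of_level \<beta> c)) \<and>
      (\<forall>c i. nth_tile_defined \<alpha> c i \<longleftrightarrow> nth_tile_defined \<beta> c i)) \<and>
     (\<forall>c d i j. c mod int n = d mod int n \<and> nth_tile_defined \<alpha> c i \<and> nth_tile_defined \<alpha> d j \<longrightarrow>
        (tile_left (nth_tile \<alpha> c i) (nth_tile \<alpha> d j) \<longleftrightarrow>
         tile_left (nth_tile \<beta> c i) (nth_tile \<beta> d j))) \<and>
     (\<forall>b\<in>outer_boundary R. \<forall>c i. nth_tile_defined \<alpha> c i \<longrightarrow>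
        (tile_left_square (nth_tile \<alpha> c i) b \<longleftrightarrow> tile_left_square (nth_tile \<beta> c i) b) \<and>
        (square_left_tile b (nth_tile \<alpha> c i) \<longleftrightarrow> square_left_tile b (nth_tile \<beta> c i)))"
proof -
  interpret two_tilings n R \<alpha> \<beta>
    using assms by unfold_locales (auto simp: simply_connected_region_def region_def)
  have "b \<notin> R" if "b \<in> outer_boundary R" for b
    using that by (simp add: outer_boundary_def)
  then show ?thesis
    using card_tiles_of_level_eq nth_tile_defined_eq tile_left_eq[OF assms(2)]
      tile_square_left_eq[OF assms(2)] by blast
qed

end
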